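(* For every $y>\mathbf{E}^\mu[X]$ there exists $\alpha^\ast(y)\in(1,\hat\alpha(y))$ which attains the unique maximum of the function $\alpha\mapsto \hat L(\alpha,y)$, $\alpha\in(1,\infty)$, where $\hat L(\alpha,y)=L(\alpha,\delta^\ast(\alpha,y),y)$.
   Context: $X$ is a real-valued, positive random variable on a probability space $(\mathcal X,\mu)$, with $g(\xi)=\mathbf{E}^\mu[e^{\xi X}]<\infty$ for $\xi\in(-\infty,\xi^\ast)$, $\xi^\ast>0$. The rate function is $I_\mu(t)=\sup_\xi\{\xi t-\log g(\xi)\}$. The Legendre dual is $\Xi(t)=\arg\sup_{\xi\ge 0}\{\xi t-\log g(\xi)\}$ if $t\ge \mathbf{E}^\mu[X]$, and $\Xi(t)=\arg\sup_{\xi\le 0}\{\xi t-\log g(\xi)\}$ if $t<\mathbf{E}^\mu[X]$. Standing assumption: $\Xi$ is well defined (supremum attained in $(-\infty,\xi^\ast)$) on $[\mathbf{E}^\mu[X],\infty)$, increasing and concave, with $\Xi(\mathbf{E}^\mu[X])=0$. For $\xi<\xi^\ast$ the tilted probability measure is $\nu_\xi(dt)=g(\xi)^{-1}e^{\xi t}\mu(dt)$ ($\mu(dt)$ denoting the law of $X$). For $y>\mathbf{E}^\mu[X]$ and $\alpha>1$, $I_\alpha(t)=\sup_\theta\{\theta t-\log\mathbf{E}[e^{\theta Y}]\}$ with $Y\sim\nu_{\Xi(\alpha y)}$ (so $I_\alpha$ also depends on $y$). Equivalently, for $\delta\ge\alpha$, $$I_\alpha(\delta y)=y(\alpha-\delta)\Xi(\alpha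 y)+\int_{\alpha y}^{\delta y}\Xi(t)\,dt,\qquad I_\alpha(y)=y(\alpha-1)\Xi(\alpha y)-\int_y^{\alpha y}\Xi(t)\,dt.$$ For $1<\alpha<\delta$ define $$L(\alpha,\delta,y)=\left(1-e^{-I_\alpha(\delta y)}-e^{-I_\alpha(y)}\right)\exp\left\{-I_\mu(\alpha y)-\Xi(\alpha y)\,y\,(\delta-\alpha)\right\}.$$ Define $A(\alpha,y)=\exp\{-I_\alpha(y)\}$, $\delta^\ast(\alpha,y)=\dfrac{\alpha-A(\alpha,y)}{1-A(\alpha,y)}$ and $\hat B(\alpha,y)=\exp\{-I_\alpha(y\,\delta^\ast(\alpha,y))\}$ for $\alpha>1$. $\check\alpha(y)\in(1,\infty)$ denotes the unique minimizer of $\alpha\mapsto\delta^\ast(\alpha,y)$ on $(1,\infty)$. $\hat\alpha(y)$ denotes the unique point of $(1,\check\alpha(y))$ such that $A(\hat\alpha(y),y)+\hat B(\hat\alpha(y),y)=1$ and $A(\alpha,y)+\hat B(\alpha,y)<1$ for all $\alpha\in(1,\hat\alpha(y))$. (The paper establishes the existence and uniqueness of $\check\alpha(y)$ and $\hat\alpha(y)$ in preceding lemmas.) *)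

theory Defs
  imports "HOL-Probability.Probability"
begin

text \<open>
  All objects depend on the random variable only through its law, a probability measure
  \<open>N\<close> on the reals.  \<open>mgf\<close> is meaningful only on \<open>mgf_dom\<close>, where the generating function is
  finite (elsewhere the Bochner integral is 0).
\<close>

definition mgf :: "real measure \<Rightarrow> real \<Rightarrow> real" where
  "mgf N \<xi> = (\<integral>t. exp (\<xi> * t) \<partial>N)"

definition mgf_dom :: "real measure \<Rightarrow> real set" where
  "mgf_dom N = {\<xi>. integrable N (\<lambda>t. exp (\<xi> * t))}"

text \<open>
  Points with infinite generating function contribute \<open>-\<infinity>\<close> to the supremum over all \<open>\<xi>\<close>, so
  restricting the supremum to \<open>mgf_dom\<close> does not change it.  The value is a real number;
  where the extended-real supremum is \<open>\<infinity>\<close> it is unspecified.  Under the standing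
  assumptions the suprema below at points at least the mean are finite, also for the tilted laws.
\<close>

definition rate :: "real measure \<Rightarrow> real \<Rightarrow> real" where
  "rate N t = (SUP \<xi>\<in>mgf_dom N. \<xi> * t - ln (mgf N \<xi>))"

definition legendre_dual :: "real measure \<Rightarrow> real \<Rightarrow> real" where
  "legendre_dual N t =
     (if t \<ge> (\<integral>x. x \<partial>N)
      then arg_max_on (\<lambda>\<xi>. \<xi> * t - ln (mgf N \<xi>)) {\<xi> \<in> mgf_dom N. \<xi> \<ge> 0}
      else arg_max_on (\<lambda>\<xi>. \<xi> * t - ln (mgf N \<xi>)) {\<xi> \<in> mgf_dom N. \<xi> \<le> 0})"

definition tilted :: "real measure \<Rightarrow> real \<Rightarrow> real measure" where
  "tilted N \<xi> = density N (\<lambda>t. ennreal (exp (\<xi> * t) / mgf N \<xi>))"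

text \<open>The paper's \<open>I\<^sub>\<alpha>(t)\<close>, with its dependence on \<open>y\<close> made explicit.\<close>

definition tilted_rate :: "real measure \<Rightarrow> real \<Rightarrow> real \<Rightarrow> real \<Rightarrow> real" where
  "tilted_rate N \<alpha> y t = rate (tilted N (legendre_dual N (\<alpha> * y))) t"

definition L_fun :: "real measure \<Rightarrow> real \<Rightarrow> real \<Rightarrow> real \<Rightarrow> real" where
  "L_fun N \<alpha> \<delta> y =
     (1 - exp (- tilted_rate N \<alpha> y (\<delta> * y)) - exp (- tilted_rate N \<alpha> y y))
     * exp (- rate N (\<alpha> * y) - legendre_dual N (\<alpha> * y) * y * (\<delta> - \<alpha>))"

definition A_fun :: "real measure \<Rightarrow> real \<Rightarrow> real \<Rightarrow> real" where
  "A_fun N \<alpha> y = exp (- tilted_rate N \<alpha> y y)"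

definition delta_star :: "real measure \<Rightarrow> real \<Rightarrow> real \<Rightarrow> real" where
  "delta_star N \<alpha> y = (\<alpha> - A_fun N \<alpha> y) / (1 - A_fun N \<alpha> y)"

definition B_hat :: "real measure \<Rightarrow> real \<Rightarrow> real \<Rightarrow> real" where
  "B_hat N \<alpha> y = exp (- tilted_rate N \<alpha> y (y * delta_star N \<alpha> y))"

definition L_hat :: "real measure \<Rightarrow> real \<Rightarrow> real \<Rightarrow> real" where
  "L_hat N \<alpha> y = L_fun N \<alpha> (delta_star N \<alpha> y) y"

definition alpha_check :: "real measure \<Rightarrow> real \<Rightarrow> real" where
  "alpha_check N y = (THE a. is_arg_min (\<lambda>\<alpha>. delta_star N \<alpha> y) (\<lambda>\<alpha>. 1 < \<alpha>) a)"

definition alpha_hat :: "real measure \<Rightarrow> real \<Rightarrow> real" where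
  "alpha_hat N y = (THE a. a \<in> {1<..<alpha_check N y} \<and>
      A_fun N a y + B_hat N a y = 1 \<and>
      (\<forall>\<alpha>\<in>{1<..<a}. A_fun N \<alpha> y + B_hat N \<alpha> y < 1))"

end

theory Submission
  imports Defs "HOL-Real_Asymp.Real_Asymp"
begin

text \<open>
  Fix \<open>y\<close> above the mean, put \<open>c = \<Xi>(y) > 0\<close> and use \<open>\<kappa> = \<Xi>(\<alpha> y)\<close> instead of \<open>\<alpha>\<close> as the
  variable; \<open>\<alpha> \<mapsto> \<kappa>\<close> is an increasing bijection from \<open>(1,\<infinity>)\<close> onto the admissible \<open>\<kappa> > c\<close>.  Let
  \<open>G0(\<kappa>) = E[exp(\<kappa>(X - y))]\<close>, so that \<open>G0'(c) = 0\<close>, and let \<open>F = G0 - G0(c)\<close> and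
  \<open>D = F'/F = (ln F)'\<close>.  At an attained dual point the rate function of a tilted law is
  explicit (\<open>tilted_rate_critical\<close>), and all quantities of the theorem become

    \<open>A = G0(c)/G0(\<kappa>)\<close>,  \<open>y \<delta>* = y + D(\<kappa>)\<close>,
    \<open>L^(\<alpha>,y) = F(\<kappa>) exp(-\<kappa> D) - G0(\<eta>) exp(-\<eta> D)\<close>  with  \<open>\<eta> = \<Xi>(y + D(\<kappa>))\<close>.

  Here \<open>\<eta>\<close> minimizes \<open>ln G0(\<eta>) - \<eta> D\<close>, and \<open>L^\<close> has the sign of \<open>1 - A - B^\<close>.  Geometrically,
  \<open>1 - A - B^\<close> is positive, zero or negative according to whether the tangent of \<open>ln F\<close> at \<open>\<kappa>\<close>
  rises above, touches or stays below the graph of \<open>ln G0\<close>.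

  \<^bold>\<open>The point \<open>\<alpha>\<close>-check.\<close>  \<open>F''\<close> is a Laplace transform, hence \<open>F'''/F''\<close> increases.  From this
  \<open>F''/F'\<close> and then \<open>F'/F = D\<close> inherit the shape "strictly decreasing, then strictly increasing"
  (\<open>G3_at_critical\<close>, \<open>D1_pos_after\<close>, \<open>turning_point\<close>).  So \<open>\<delta>*\<close> has exactly one minimizer, and it
  is the inflection point of \<open>ln F\<close>.

  \<^bold>\<open>The point \<open>\<alpha>\<close>-hat.\<close>  To the right of the inflection point \<open>ln F\<close> is convex, so its tangent
  stays below \<open>ln F < ln G0\<close> there and \<open>A + B^ > 1\<close> (\<open>gap_pos_after\<close>).  To the left of it the
  tangents of the concave function \<open>ln F\<close> sink strictly as \<open>\<kappa>\<close> increases (\<open>gap_strict\<close>), and near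
  \<open>c\<close> they are arbitrarily steep (\<open>gap_neg_near_c\<close>).  So \<open>1 - A - B^\<close> changes sign exactly once,
  and \<open>L^\<close> is positive exactly for \<open>\<alpha>\<close> below \<open>\<alpha>\<close>-hat.

  \<^bold>\<open>The maximizer.\<close>  By the envelope principle \<open>dL^/d\<kappa>\<close> is \<open>D'(\<kappa>) < 0\<close> times a quantity with
  the sign of \<open>\<rho> = ln \<eta> - ln \<kappa> + (ln G0(\<eta>) - \<eta> D) - (ln F(\<kappa>) - \<kappa> D)\<close>.  The derivative of
  \<open>\<rho>\<close> is \<open>-D' \<Omega>\<close> with \<open>\<Omega> = (\<eta> - \<kappa>) - \<Xi>'/\<Xi>(y + D) - 1/(\<kappa> (-D'))\<close>.  The first two
  terms of \<open>\<Omega>\<close> decrease in \<open>\<kappa>\<close> because \<open>D\<close> decreases and \<open>\<Xi>\<close> is concave; the last one decreases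
  because \<open>-\<kappa> D'\<close> does, which is the delicate estimate (\<open>T_pos\<close>, \<open>kappa_D1_strict\<close>).  Hence
  \<open>\<rho>\<close> increases and then decreases; as it is positive at \<open>\<alpha>\<close>-hat, it changes sign at most once, from
  minus to plus.  Since \<open>L^\<close> is positive below \<open>\<alpha>\<close>-hat and tends to \<open>0\<close> as \<open>\<alpha>\<close> tends to \<open>1\<close>, the
  sign change does occur, and it is the unique maximizer of \<open>L^\<close> (\<open>unique_maximum\<close>).
\<close>

section \<open>Sign changes of functions that cross zero upwards\<close>

text \<open>
  A function that can only cross zero upwards never returns to zero.  Applied to differences of
  logarithmic derivatives and to \<open>T\<close> below, this turns a differential inequality that is known only
  on the zero set into a global sign.
\<close>

lemma positive_after_upward_crossings:
  fixes \<phi> \<phi>' :: "real \<Rightarrow> real"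
  assumes "a < b"
    and deriv: "\<And>s. s \<in> {a..b} \<Longrightarrow> (\<phi> has_real_derivative \<phi>' s) (at s)"
    and cross: "\<And>s. s \<in> {a..b} \<Longrightarrow> \<phi> s = 0 \<Longrightarrow> \<phi>' s > 0"
    and start: "\<phi> a \<ge> 0"
  shows "\<phi> b > 0"
proof (rule ccontr)
  assume neg: "\<not> \<phi> b > 0"
  have cont: "continuous_on {u..u'} \<phi>" if "a \<le> u" "u' \<le> b" for u u'
  proof (rule continuous_at_imp_continuous_on, safe)
    fix s assume "s \<in> {u..u'}"
    then have "s \<in> {a..b}" using that by auto
    then show "isCont \<phi> s" using deriv DERIV_isCont by blast
  qed
  obtain a' where a': "a \<le> a'" "a' < b" "\<phi> a' > 0"
  proof (cases "\<phi> a = 0")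
    case True
    then obtain d where d: "d > 0" "\<And>h. h > 0 \<Longrightarrow> h < d \<Longrightarrow> \<phi> a < \<phi> (a + h)"
      using DERIV_pos_inc_right[OF deriv[of a] cross[of a]] \<open>a < b\<close> by auto
    define h where "h = min (d/2) ((b-a)/2)"
    have "h > 0" "h < d" "a + h < b" using d \<open>a < b\<close> by (auto simp: h_def min_def field_simps)
    then show ?thesis using that[of "a+h"] d True by auto
  next
    case False
    then show ?thesis using that[of a] start \<open>a < b\<close> by auto
  qed
  \<comment> \<open>The first nonpositive point after \<open>a'\<close> would be a zero with nonpositive left slope.\<close>
  define Q where "Q = {s \<in> {a'..b}. \<phi> s \<le> 0}"
  have "closed Q" unfolding Q_def
    by (intro continuous_on_closed_Collect_le cont continuous_intros a') (use a' in auto)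
  then have "compact Q"
    by (metis (no_types, lifting) Q_def bounded_closed_interval bounded_subset compact_eq_bounded_closed mem_Collect_eq subsetI)
  moreover have "b \<in> Q" using neg a' by (auto simp: Q_def)
  ultimately obtain s where s: "s \<in> Q" "\<And>t. t \<in> Q \<Longrightarrow> s \<le> t"
    using compact_attains_inf[of Q] by blast
  have "s > a'" using s(1) a' by (cases "s = a'") (auto simp: Q_def)
  have "\<phi> s = 0"
  proof (rule ccontr)
    assume "\<phi> s \<noteq> 0"
    then have "\<phi> s \<le> 0" "\<phi> s < 0" using s(1) by (auto simp: Q_def)
    then obtain t where "a' \<le> t" "t \<le> s" "\<phi> t = 0"
      using IVT2'[of \<phi> s 0 a'] a' \<open>s > a'\<close> cont[of a' s] s(1) by (auto simp: Q_def)
    then have "t \<in> Q" using s(1) by (auto simp: Q_def)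
    then show False using s(2)[of t] \<open>t \<le> s\<close> \<open>\<phi> t = 0\<close> \<open>\<phi> s \<noteq> 0\<close> by auto
  qed
  have sab: "s \<in> {a..b}" using s(1) a' by (auto simp: Q_def)
  obtain d where d: "d > 0" "\<And>h. h > 0 \<Longrightarrow> h < d \<Longrightarrow> \<phi> (s - h) < \<phi> s"
    using DERIV_pos_inc_left[OF deriv[OF sab] cross[OF sab \<open>\<phi> s = 0\<close>]] by auto
  define h where "h = min (d/2) ((s-a')/2)"
  have h: "h > 0" "h < d" "s - h > a'" using d \<open>s > a'\<close> by (auto simp: h_def min_def field_simps)
  then have "s - h \<in> Q" using d(2)[of h] \<open>\<phi> s = 0\<close> s(1) by (auto simp: Q_def)
  then show False using s(2)[of "s-h"] h by auto
qed

text \<open>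
  The algebraic core of \<open>T_pos\<close>: with \<open>z = x + d\<close> the last premise is \<open>T = 0\<close>, and the conclusion
  bounds the derivative of \<open>T\<close> with respect to \<open>ln (\<kappa> - c)\<close> from below.  Eliminating \<open>w\<close> and
  substituting \<open>x = 1 + a\<close> leaves \<open>d\<close> times a polynomial in \<open>a\<close> and \<open>d\<close> whose only negative
  term is absorbed by the square \<open>(1 - d)\<^sup>2\<close>.
\<close>
lemma crossing_polynomial_positive:
  fixes x d w :: real
  assumes "x \<ge> 1" "d > 0" and T0: "2*(x+d)^2 - (3*x+1)*(x+d) + x*(w+1) = 0"
  shows "(4*(x+d)-3*x-1)*((x+d)*(1+x-(x+d))) + x*(1+w-x)*(w+1-3*(x+d)) + x*w > 0"
proof -
  define a where "a = x - 1"
  have a: "a \<ge> 0" "x = 1 + a" using assms by (auto simp: a_def)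
  have w: "x * w = x^2 - d*(x+2*d-1)" using T0 by (simp add: algebra_simps power2_eq_square)
  have "x * ((4*(x+d)-3*x-1)*((x+d)*(1+x-(x+d))) + x*(1+w-x)*(w+1-3*(x+d)) + x*w)
     = x*(x+4*d-1)*(x+d)*(1-d) + (x + x*w - x^2)*(x*w + x - 3*x*(x+d)) + x*(x*w)"
    by (simp add: algebra_simps power2_eq_square)
  also have "\<dots> = d * ((1 - 2*d + 2*d^2) + 4*d^3 + a + 6*a*d^2 + a^2 + 3*a^2*d + a^3)"
    unfolding w unfolding a by (simp add: algebra_simps power2_eq_square power3_eq_cube)
  also have "1 - 2*d + 2*d^2 = (1-d)^2 + d^2" by (simp add: algebra_simps power2_eq_square)
  also have "d * ((1-d)^2 + d^2 + 4*d^3 + a + 6*a*d^2 + a^2 + 3*a^2*d + a^3) > 0"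
    using a \<open>d > 0\<close> by (intro mult_pos_pos add_pos_nonneg add_nonneg_pos) auto
  finally show ?thesis using \<open>x \<ge> 1\<close> by (simp add: zero_less_mult_iff)
qed

section \<open>Exponential moments around a point\<close>

text \<open>
  The analytic input of the proof, stripped of the probability space.  The model is
  \<open>Gk \<kappa> = E[Z^k exp(\<kappa> Z)]\<close> with \<open>Z = X - y\<close>, on a down-closed set \<open>S\<close> of tilting parameters;
  \<open>Xi t\<close> stands for the Legendre dual at \<open>y + t\<close>.  The two \<open>hankel\<close> inequalities are
  strict Cauchy-Schwarz inequalities for the tilted law of \<open>Z\<close> and for its reweighting by \<open>Z\<^sup>2\<close>.
\<close>
locale exponential_moments =
  fixes S :: "real set" and c :: real and G0 G1 G2 G3 G4 :: "real \<Rightarrow> real" and Xi :: "real \<Rightarrow> real"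
  assumes S_down: "\<And>\<kappa> \<kappa>'. \<kappa> \<in> S \<Longrightarrow> \<kappa>' \<le> \<kappa> \<Longrightarrow> \<kappa>' \<in> S"
    and dG0: "\<And>\<kappa>. \<kappa> \<in> S \<Longrightarrow> (G0 has_real_derivative G1 \<kappa>) (at \<kappa>)"
    and dG1: "\<And>\<kappa>. \<kappa> \<in> S \<Longrightarrow> (G1 has_real_derivative G2 \<kappa>) (at \<kappa>)"
    and dG2: "\<And>\<kappa>. \<kappa> \<in> S \<Longrightarrow> (G2 has_real_derivative G3 \<kappa>) (at \<kappa>)"
    and dG3: "\<And>\<kappa>. \<kappa> \<in> S \<Longrightarrow> (G3 has_real_derivative G4 \<kappa>) (at \<kappa>)"
    and G0_pos: "\<And>\<kappa>. \<kappa> \<in> S \<Longrightarrow> G0 \<kappa> > 0"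
    and G2_pos: "\<And>\<kappa>. \<kappa> \<in> S \<Longrightarrow> G2 \<kappa> > 0"
    and hankel02: "\<And>\<kappa>. \<kappa> \<in> S \<Longrightarrow> (G1 \<kappa>)^2 < G0 \<kappa> * G2 \<kappa>"
    and hankel24: "\<And>\<kappa>. \<kappa> \<in> S \<Longrightarrow> (G3 \<kappa>)^2 < G2 \<kappa> * G4 \<kappa>"
    and c_pos: "0 < c" and c_S: "c \<in> S" and G1_c: "G1 c = 0"
    and Xi_S: "\<And>t. t \<ge> 0 \<Longrightarrow> Xi t \<in> S"
    and Xi_ge: "\<And>t. t \<ge> 0 \<Longrightarrow> c \<le> Xi t"
    and Xi_eq: "\<And>t. t \<ge> 0 \<Longrightarrow> G1 (Xi t) = t * G0 (Xi t)"
    and Xi_concave: "concave_on {0..} Xi"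
begin

text \<open>
  \<open>mean\<close> and \<open>var\<close> are the mean (relative to \<open>y\<close>) and the variance of the tilted law, that is, the
  first two derivatives of \<open>ln G0\<close>.  \<open>D\<close> is \<open>y (\<delta>* - 1)\<close>.
\<close>
definition mean :: "real \<Rightarrow> real" where "mean \<kappa> = G1 \<kappa> / G0 \<kappa>"
definition var :: "real \<Rightarrow> real" where "var \<kappa> = G2 \<kappa> / G0 \<kappa> - (G1 \<kappa> / G0 \<kappa>)^2"
definition F :: "real \<Rightarrow> real" where "F \<kappa> = G0 \<kappa> - G0 c"
definition D :: "real \<Rightarrow> real" where "D \<kappa> = G1 \<kappa> / F \<kappa>"

lemma var_pos: "\<kappa> \<in> S \<Longrightarrow> var \<kappa> > 0"
  using hankel02[of \<kappa>] G0_pos[of \<kappa>] by (simp add: var_def field_simps power2_eq_square)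

lemma dmean: "\<kappa> \<in> S \<Longrightarrow> (mean has_real_derivative var \<kappa>) (at \<kappa>)"
  unfolding mean_def[abs_def] var_def using G0_pos[of \<kappa>]
  by (auto intro!: derivative_eq_intros dG0 dG1 simp: field_simps power2_eq_square)

lemma mean_strict: assumes "\<kappa>' \<in> S" "\<kappa> < \<kappa>'" shows "mean \<kappa> < mean \<kappa>'"
  by (rule DERIV_pos_imp_increasing[OF \<open>\<kappa> < \<kappa>'\<close>])
    (use assms S_down dmean var_pos in blast)

lemma mean_c: "mean c = 0" by (simp add: mean_def G1_c)

lemma mean_Xi: "t \<ge> 0 \<Longrightarrow> mean (Xi t) = t"
  using Xi_eq[of t] G0_pos[OF Xi_S, of t] by (simp add: mean_def)

lemma mean_pos: "\<kappa> \<in> S \<Longrightarrow> c < \<kappa> \<Longrightarrow> mean \<kappa> > 0"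
  using mean_strict[of \<kappa> c] mean_c by simp

lemma mean_inj: "\<kappa> \<in> S \<Longrightarrow> \<kappa>' \<in> S \<Longrightarrow> mean \<kappa> = mean \<kappa>' \<Longrightarrow> \<kappa> = \<kappa>'"
  using mean_strict[of \<kappa> \<kappa>'] mean_strict[of \<kappa>' \<kappa>] by (cases \<kappa> \<kappa>' rule: linorder_cases) auto

lemma Xi_mean: "\<kappa> \<in> S \<Longrightarrow> c \<le> \<kappa> \<Longrightarrow> Xi (mean \<kappa>) = \<kappa>"
  using mean_pos[of \<kappa>] mean_c mean_Xi[of "mean \<kappa>"] Xi_S[of "mean \<kappa>"] mean_inj[of "Xi (mean \<kappa>)" \<kappa>]
  by (cases "c = \<kappa>") auto

lemma Xi_0: "Xi 0 = c" using Xi_mean[OF c_S] mean_c by simp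

lemma Xi_strict: "0 \<le> s \<Longrightarrow> s < t \<Longrightarrow> Xi s < Xi t"
  using mean_strict[of "Xi s" "Xi t"] mean_Xi[of s] mean_Xi[of t] Xi_S[of s]
  by (metis mean_strict dual_order.order_iff_strict linorder_not_le order_less_le_trans)

lemma Xi_gt: "0 < t \<Longrightarrow> c < Xi t" using Xi_strict[of 0 t] Xi_0 by simp

lemma Xi_isCont: assumes "t > 0" shows "isCont Xi t"
proof -
  have "convex_on {0<..} (\<lambda>t. - Xi t)"
    using Xi_concave unfolding concave_on_def by (rule convex_on_subset) auto
  then have "continuous_on {0<..} (\<lambda>t. - Xi t)" by (intro convex_on_continuous) auto
  then have "isCont (\<lambda>t. - Xi t) t" using assms by (simp add: continuous_on_eq_continuous_at)
  then show ?thesis using isCont_minus[of t "\<lambda>t. - Xi t"] by simp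
qed

lemma dXi: assumes "t > 0" shows "(Xi has_real_derivative inverse (var (Xi t))) (at t)"
proof (rule DERIV_inverse_function[where f = mean and a = 0 and b = "t + 1"])
  show "(mean has_real_derivative var (Xi t)) (at (Xi t))" using dmean Xi_S assms by simp
  show "var (Xi t) \<noteq> 0" using var_pos[OF Xi_S, of t] assms by simp
qed (use assms mean_Xi Xi_isCont in auto)

text \<open>
  Where the concavity of the dual enters: its slope at \<open>mean \<kappa>\<close> is \<open>1 / var \<kappa>\<close>, and the slopes of
  a concave function decrease.
\<close>
lemma var_mono: assumes "\<kappa>' \<in> S" "c < \<kappa>" "\<kappa> \<le> \<kappa>'" shows "var \<kappa> \<le> var \<kappa>'"
proof (cases "\<kappa> = \<kappa>'")
  case False
  have kS: "\<kappa> \<in> S" using assms S_down by blast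
  define s t where "s = mean \<kappa>" and "t = mean \<kappa>'"
  have st: "0 < s" "s < t" using mean_pos[OF kS] mean_strict[of \<kappa>' \<kappa>] assms False by (auto simp: s_def t_def)
  have Es: "Xi s = \<kappa>" "Xi t = \<kappa>'" using Xi_mean kS assms by (auto simp: s_def t_def)
  have conv: "convex_on {0..} (\<lambda>t. - Xi t)" using Xi_concave unfolding concave_on_def .
  have tang: "- Xi b \<ge> - Xi a + - inverse (var (Xi a)) * (b - a)" if "a > 0" "b > 0" for a b
  proof -
    have "(- Xi b) - (- Xi a) \<ge> - inverse (var (Xi a)) * (b - a)"
      by (rule convex_on_imp_above_tangent[OF conv])
        (use that dXi[of a] in \<open>auto intro!: derivative_eq_intros simp: has_field_derivative_at_within\<close>)
    then show ?thesis by simp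
  qed
  have "(inverse (var \<kappa>) - inverse (var \<kappa>')) * (t - s) \<ge> 0"
    using tang[of s t] tang[of t s] st Es by (simp add: algebra_simps)
  then have "inverse (var \<kappa>') \<le> inverse (var \<kappa>)" using st by (simp add: zero_le_mult_iff)
  then show ?thesis using var_pos kS assms by (simp add: inverse_le_iff_le)
qed simp

lemma G1_pos: "\<kappa> \<in> S \<Longrightarrow> c < \<kappa> \<Longrightarrow> G1 \<kappa> > 0"
  using mean_pos[of \<kappa>] G0_pos[of \<kappa>] by (simp add: mean_def zero_less_divide_iff)

lemma F_pos: assumes "\<kappa> \<in> S" "c < \<kappa>" shows "F \<kappa> > 0"
proof -
  have "\<exists>z. c < z \<and> z < \<kappa> \<and> G0 \<kappa> - G0 c = (\<kappa> - c) * G1 z"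
    by (rule MVT2) (use assms S_down dG0 in auto)
  then obtain z where "c < z" "z < \<kappa>" "F \<kappa> = (\<kappa> - c) * G1 z" by (auto simp: F_def)
  then show ?thesis using G1_pos[of z] assms S_down[of \<kappa> z] by simp
qed

lemma F_less: "\<kappa> \<in> S \<Longrightarrow> F \<kappa> < G0 \<kappa>" using G0_pos[OF c_S] by (simp add: F_def)

lemma dF: "\<kappa> \<in> S \<Longrightarrow> (F has_real_derivative G1 \<kappa>) (at \<kappa>)"
  unfolding F_def[abs_def] by (auto intro!: derivative_eq_intros dG0)

lemma F_c: "F c = 0" by (simp add: F_def)

text \<open>Every factor of \<open>G2 = G0 (var + mean\<^sup>2)\<close> is increasing to the right of \<open>c\<close>.\<close>
lemma G2_mono: assumes "\<kappa>' \<in> S" "c < \<kappa>" "\<kappa> \<le> \<kappa>'" shows "G2 \<kappa> \<le> G2 \<kappa>'"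
proof -
  have kS: "\<kappa> \<in> S" using assms S_down by blast
  have eq: "G2 s = G0 s * (var s + (mean s)^2)" if "s \<in> S" for s
    using G0_pos[OF that] by (simp add: var_def mean_def)
  have "G0 \<kappa> \<le> G0 \<kappa>'"
    by (rule DERIV_nonneg_imp_nondecreasing[OF assms(3)]) (use assms S_down G1_pos dG0 in \<open>meson less_imp_le order_less_le_trans\<close>)
  moreover have "0 < mean \<kappa>" "mean \<kappa> \<le> mean \<kappa>'"
    using mean_pos[OF kS] mean_strict[of \<kappa>' \<kappa>] assms by (cases "\<kappa> = \<kappa>'"; simp)+
  moreover have "0 < var \<kappa>" "var \<kappa> \<le> var \<kappa>'" "0 < G0 \<kappa>" using var_pos kS var_mono assms G0_pos by auto
  ultimately show ?thesis unfolding eq[OF kS] eq[OF assms(1)]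
    by (intro mult_mono add_mono power_mono) auto
qed

lemma G1_le_xi_G2: assumes "\<kappa> \<in> S" "c < \<kappa>" shows "G1 \<kappa> \<le> (\<kappa> - c) * G2 \<kappa>"
proof -
  have "\<exists>z. c < z \<and> z < \<kappa> \<and> G1 \<kappa> - G1 c = (\<kappa> - c) * G2 z"
    by (rule MVT2) (use assms S_down dG1 in auto)
  then show ?thesis using G2_mono[of \<kappa>] assms by (auto simp: G1_c)
qed

section \<open>The logarithmic derivative of F turns once\<close>

text \<open>
  \<open>D1\<close> is the derivative of \<open>D\<close>.  The numbers \<open>z\<close>, \<open>x\<close>, \<open>w\<close> are the logarithmic derivatives of
  \<open>F\<close>, \<open>F'\<close>, \<open>F''\<close> with respect to \<open>ln (\<kappa> - c)\<close>; they satisfy a triangular system of differential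
  equations and tend to \<open>2, 1, 0\<close> at \<open>c\<close>.  In these coordinates \<open>T\<close> carries the sign of the
  derivative of \<open>(\<kappa> - c) D1(\<kappa>)\<close>: that derivative equals \<open>D T / (\<kappa> - c)\<close>.
\<close>
definition D1 :: "real \<Rightarrow> real" where "D1 \<kappa> = (G2 \<kappa> * F \<kappa> - (G1 \<kappa>)^2) / (F \<kappa>)^2"
definition z :: "real \<Rightarrow> real" where "z \<kappa> = (\<kappa> - c) * G1 \<kappa> / F \<kappa>"
definition x :: "real \<Rightarrow> real" where "x \<kappa> = (\<kappa> - c) * G2 \<kappa> / G1 \<kappa>"
definition w :: "real \<Rightarrow> real" where "w \<kappa> = (\<kappa> - c) * G3 \<kappa> / G2 \<kappa>"
definition T :: "real \<Rightarrow> real" where "T \<kappa> = 2 * (z \<kappa>)^2 - (3 * x \<kappa> + 1) * z \<kappa> + x \<kappa> * (w \<kappa> + 1)"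

lemma dD: "\<kappa> \<in> S \<Longrightarrow> c < \<kappa> \<Longrightarrow> (D has_real_derivative D1 \<kappa>) (at \<kappa>)"
  unfolding D_def[abs_def] D1_def using F_pos[of \<kappa>]
  by (auto intro!: derivative_eq_intros dG1 dF simp: field_simps power2_eq_square)

lemma D_pos: "\<kappa> \<in> S \<Longrightarrow> c < \<kappa> \<Longrightarrow> D \<kappa> > 0"
  using F_pos G1_pos by (simp add: D_def)

lemma dz: "\<kappa> \<in> S \<Longrightarrow> c < \<kappa> \<Longrightarrow> (z has_real_derivative z \<kappa> * (1 + x \<kappa> - z \<kappa>) / (\<kappa> - c)) (at \<kappa>)"
  unfolding z_def[abs_def] x_def using F_pos[of \<kappa>] G1_pos[of \<kappa>]
  by (auto intro!: derivative_eq_intros dG1 dF simp: field_simps power2_eq_square)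

lemma dx: "\<kappa> \<in> S \<Longrightarrow> c < \<kappa> \<Longrightarrow> (x has_real_derivative x \<kappa> * (1 + w \<kappa> - x \<kappa>) / (\<kappa> - c)) (at \<kappa>)"
  unfolding x_def[abs_def] w_def using G2_pos[of \<kappa>] G1_pos[of \<kappa>]
  by (auto intro!: derivative_eq_intros dG1 dG2 simp: field_simps power2_eq_square)

lemma dw: "\<kappa> \<in> S \<Longrightarrow> c < \<kappa> \<Longrightarrow> (w has_real_derivative
    (w \<kappa> + (\<kappa> - c)^2 * (G2 \<kappa> * G4 \<kappa> - (G3 \<kappa>)^2) / (G2 \<kappa>)^2) / (\<kappa> - c)) (at \<kappa>)"
  unfolding w_def[abs_def] using G2_pos[of \<kappa>]
  by (auto intro!: derivative_eq_intros dG2 dG3 simp: field_simps power2_eq_square)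

lemma D1_zx: "\<kappa> \<in> S \<Longrightarrow> c < \<kappa> \<Longrightarrow> (\<kappa> - c) * D1 \<kappa> = D \<kappa> * (x \<kappa> - z \<kappa>)"
  unfolding x_def z_def D1_def D_def using F_pos[of \<kappa>] G1_pos[of \<kappa>]
  by (simp add: field_simps power2_eq_square)

lemma eventually_S: "eventually (\<lambda>\<kappa>. \<kappa> \<in> S \<and> c < \<kappa>) (at_right c)"
proof -
  have "c < Xi 1" "Xi 1 \<in> S" using Xi_gt[of 1] Xi_S[of 1] by auto
  then show ?thesis unfolding eventually_at_right_field using S_down[of "Xi 1"]
    by (intro exI[of _ "Xi 1"]) auto
qed

lemma cont_c: "(f has_real_derivative f') (at c) \<Longrightarrow> (f \<longlongrightarrow> f c) (at_right c)"
  using DERIV_isCont[of f f' c] by (simp add: isCont_def filterlim_at_split)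

lemma lim_G1: "((\<lambda>\<kappa>. G1 \<kappa> / (\<kappa> - c)) \<longlongrightarrow> G2 c) (at_right c)"
  using dG1[OF c_S] G1_c by (simp add: has_field_derivative_iff filterlim_at_split)

lemma lim_F: "((\<lambda>\<kappa>. F \<kappa> / (\<kappa> - c)^2) \<longlongrightarrow> G2 c / 2) (at_right c)"
proof (rule lhopital_right)
  show "(F \<longlongrightarrow> 0) (at_right c)" using cont_c[OF dF[OF c_S]] F_c by simp
  show "((\<lambda>\<kappa>. (\<kappa> - c)^2) \<longlongrightarrow> 0) (at_right c)" by (auto intro!: tendsto_eq_intros)
  show "\<forall>\<^sub>F \<kappa> in at_right c. (\<kappa> - c)^2 \<noteq> 0" using eventually_S by eventually_elim auto
  show "\<forall>\<^sub>F \<kappa> in at_right c. 2 * (\<kappa> - c) \<noteq> 0" using eventually_S by eventually_elim auto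
  show "\<forall>\<^sub>F \<kappa> in at_right c. (F has_real_derivative G1 \<kappa>) (at \<kappa>)"
    using eventually_S by eventually_elim (auto intro: dF)
  show "\<forall>\<^sub>F \<kappa> in at_right c. ((\<lambda>\<kappa>. (\<kappa> - c)^2) has_real_derivative 2 * (\<kappa> - c)) (at \<kappa>)"
    by (intro always_eventually allI) (auto intro!: derivative_eq_intros)
  show "((\<lambda>\<kappa>. G1 \<kappa> / (2 * (\<kappa> - c))) \<longlongrightarrow> G2 c / 2) (at_right c)"
    using tendsto_divide[OF lim_G1 tendsto_const[of 2]] by (simp add: mult.commute)
qed

lemma lim_z: "(z \<longlongrightarrow> 2) (at_right c)"
proof -
  have "((\<lambda>\<kappa>. (G1 \<kappa> / (\<kappa> - c)) / (F \<kappa> / (\<kappa> - c)^2)) \<longlongrightarrow> G2 c / (G2 c / 2)) (at_right c)"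
    using G2_pos[OF c_S] by (intro tendsto_divide lim_G1 lim_F) auto
  then have "((\<lambda>\<kappa>. (G1 \<kappa> / (\<kappa> - c)) / (F \<kappa> / (\<kappa> - c)^2)) \<longlongrightarrow> 2) (at_right c)"
    using G2_pos[OF c_S] by simp
  then show ?thesis
    by (rule Lim_transform_eventually)
      (use eventually_S in eventually_elim, auto simp: z_def power2_eq_square)
qed

lemma lim_x: "(x \<longlongrightarrow> 1) (at_right c)"
proof -
  have "((\<lambda>\<kappa>. G2 \<kappa> / (G1 \<kappa> / (\<kappa> - c))) \<longlongrightarrow> G2 c / G2 c) (at_right c)"
    using G2_pos[OF c_S] by (intro tendsto_divide lim_G1 cont_c[OF dG2[OF c_S]]) auto
  then show ?thesis using G2_pos[OF c_S] by (simp add: x_def[abs_def] mult.commute)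
qed

lemma lim_w: "(w \<longlongrightarrow> 0) (at_right c)"
proof -
  have "((\<lambda>\<kappa>. (\<kappa> - c) * G3 \<kappa> / G2 \<kappa>) \<longlongrightarrow> (c - c) * G3 c / G2 c) (at_right c)"
    using G2_pos[OF c_S]
    by (intro tendsto_divide tendsto_mult tendsto_diff tendsto_const tendsto_ident_at
        cont_c[OF dG2[OF c_S]] cont_c[OF dG3[OF c_S]]) auto
  then show ?thesis by (simp add: w_def[abs_def])
qed

lemma lim_T: "(T \<longlongrightarrow> 1) (at_right c)"
proof -
  have "(T \<longlongrightarrow> 2 * 2^2 - (3 * 1 + 1) * 2 + 1 * (0 + 1)) (at_right c)"
    unfolding T_def[abs_def] by (intro tendsto_intros lim_x lim_z lim_w)
  then show ?thesis by simp
qed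

text \<open>
  At a critical point of \<open>D\<close> the quotient \<open>F''/F'\<close> is already increasing.  Otherwise, since
  \<open>F'''/F'' - F''/F'\<close> crosses zero only upwards, \<open>F''/F'\<close> would be strictly decreasing up to \<open>s\<close>, so
  \<open>F'' > r F'\<close> on \<open>(c, s)\<close> with \<open>r\<close> its value at \<open>s\<close>; integrating from \<open>c\<close>, where \<open>F\<close> and
  \<open>F'\<close> vanish, gives \<open>F'(s) > r F(s)\<close>, which contradicts criticality.
\<close>
lemma G3_at_critical:
  assumes s: "s \<in> S" "c < s" and crit: "G2 s * F s = (G1 s)^2"
  shows "(G2 s)^2 < G1 s * G3 s"
proof (rule ccontr)
  assume neg: "\<not> (G2 s)^2 < G1 s * G3 s"
  define \<psi> where "\<psi> \<kappa> = G3 \<kappa> / G2 \<kappa> - G2 \<kappa> / G1 \<kappa>" for \<kappa>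
  define \<psi>' where "\<psi>' \<kappa> = (G2 \<kappa> * G4 \<kappa> - (G3 \<kappa>)^2) / (G2 \<kappa>)^2
    - (G1 \<kappa> * G3 \<kappa> - (G2 \<kappa>)^2) / (G1 \<kappa>)^2" for \<kappa>
  have d\<psi>: "(\<psi> has_real_derivative \<psi>' \<kappa>) (at \<kappa>)" if "\<kappa> \<in> S" "c < \<kappa>" for \<kappa>
    unfolding \<psi>_def[abs_def] \<psi>'_def using G1_pos[OF that] G2_pos[of \<kappa>] that
    by (auto intro!: derivative_eq_intros dG1 dG2 dG3 simp: field_simps power2_eq_square)
  have cross: "\<psi>' \<kappa> > 0" if "\<kappa> \<in> S" "c < \<kappa>" "\<psi> \<kappa> = 0" for \<kappa>
  proof -
    have "G1 \<kappa> * G3 \<kappa> = (G2 \<kappa>)^2"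
      using that G1_pos[of \<kappa>] G2_pos[of \<kappa>] by (simp add: \<psi>_def field_simps power2_eq_square)
    then show ?thesis using hankel24[of \<kappa>] G2_pos[of \<kappa>] that by (simp add: \<psi>'_def)
  qed
  have "\<psi> s \<le> 0" using neg s G1_pos[of s] G2_pos[of s]
    by (simp add: \<psi>_def field_simps power2_eq_square)
  have less: "G1 \<kappa> * G3 \<kappa> < (G2 \<kappa>)^2" if \<kappa>: "c < \<kappa>" "\<kappa> < s" for \<kappa>
  proof -
    have "\<psi> \<kappa> < 0"
    proof (rule ccontr)
      assume "\<not> \<psi> \<kappa> < 0"
      then have "\<psi> s > 0"
        using \<kappa> s S_down d\<psi> cross by (intro positive_after_upward_crossings[of \<kappa> s \<psi> \<psi>']) auto
      then show False using \<open>\<psi> s \<le> 0\<close> by simp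
    qed
    then show ?thesis using \<kappa> s S_down[of s \<kappa>] G1_pos[of \<kappa>] G2_pos[of \<kappa>]
      by (simp add: \<psi>_def field_simps power2_eq_square)
  qed
  define r where "r = G2 s / G1 s"
  have dr: "((\<lambda>\<kappa>. G2 \<kappa> / G1 \<kappa>) has_real_derivative (G1 \<kappa> * G3 \<kappa> - (G2 \<kappa>)^2) / (G1 \<kappa>)^2) (at \<kappa>)"
    if "\<kappa> \<in> S" "c < \<kappa>" for \<kappa>
    using G1_pos[OF that] that
    by (auto intro!: derivative_eq_intros dG1 dG2 simp: field_simps power2_eq_square)
  have r_less: "r < G2 \<kappa> / G1 \<kappa>" if \<kappa>: "c < \<kappa>" "\<kappa> < s" for \<kappa>
    unfolding r_def
  proof (rule DERIV_neg_imp_decreasing_open[OF \<kappa>(2)])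
    fix t assume t: "\<kappa> < t" "t < s"
    then have "t \<in> S" "c < t" using S_down[of s t] s \<kappa> by auto
    then show "\<exists>y. ((\<lambda>\<kappa>. G2 \<kappa> / G1 \<kappa>) has_real_derivative y) (at t) \<and> y < 0"
      using dr less[of t] t G1_pos[of t] by (intro exI[of _ "(G1 t * G3 t - (G2 t)^2) / (G1 t)^2"])
        (auto simp: divide_less_0_iff)
  next
    show "continuous_on {\<kappa>..s} (\<lambda>\<kappa>. G2 \<kappa> / G1 \<kappa>)"
    proof (intro continuous_at_imp_continuous_on ballI)
      fix t assume "t \<in> {\<kappa>..s}"
      then have "t \<in> S" "c < t" using S_down[of s t] s \<kappa> by auto
      then show "isCont (\<lambda>\<kappa>. G2 \<kappa> / G1 \<kappa>) t" by (rule DERIV_isCont[OF dr])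
    qed
  qed
  have dq: "((\<lambda>\<kappa>. G1 \<kappa> - r * F \<kappa>) has_real_derivative G2 \<kappa> - r * G1 \<kappa>) (at \<kappa>)" if "\<kappa> \<in> S" for \<kappa>
    using that by (auto intro!: derivative_eq_intros dG1 dF)
  have "G1 c - r * F c < G1 s - r * F s"
  proof (rule DERIV_pos_imp_increasing_open[OF s(2)])
    fix t assume t: "c < t" "t < s"
    then have "t \<in> S" using S_down[of s t] s by auto
    then show "\<exists>y. ((\<lambda>\<kappa>. G1 \<kappa> - r * F \<kappa>) has_real_derivative y) (at t) \<and> y > 0"
      using dq[of t] r_less[OF t] G1_pos[of t] t
      by (intro exI[of _ "G2 t - r * G1 t"]) (auto simp: field_simps)
  next
    show "continuous_on {c..s} (\<lambda>\<kappa>. G1 \<kappa> - r * F \<kappa>)"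
      using s S_down dq by (intro continuous_at_imp_continuous_on ballI DERIV_isCont) auto
  qed
  then show False using crit G1_pos[OF s] by (simp add: G1_c F_c r_def field_simps power2_eq_square)
qed

text \<open>
  \<open>D1\<close> has the sign of \<open>F''/F' - F'/F\<close>, which crosses zero only upwards because at a zero the
  second quotient is stationary while the first one increases.
\<close>
lemma D1_pos_after:
  assumes "a < b" "c < a" "b \<in> S" "D1 a \<ge> 0" shows "D1 b > 0"
proof -
  define \<phi> where "\<phi> \<kappa> = G2 \<kappa> / G1 \<kappa> - G1 \<kappa> / F \<kappa>" for \<kappa>
  define \<phi>' where "\<phi>' \<kappa> = (G1 \<kappa> * G3 \<kappa> - (G2 \<kappa>)^2) / (G1 \<kappa>)^2
     - (G2 \<kappa> * F \<kappa> - (G1 \<kappa>)^2) / (F \<kappa>)^2" for \<kappa>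
  have D1_eq: "D1 \<kappa> = D \<kappa> * \<phi> \<kappa>" if "\<kappa> \<in> S" "c < \<kappa>" for \<kappa>
    using F_pos[OF that] G1_pos[OF that]
    by (simp add: D1_def D_def \<phi>_def field_simps power2_eq_square)
  have "\<phi> b > 0"
  proof (rule positive_after_upward_crossings[OF assms(1)])
    fix s assume "s \<in> {a..b}"
    then have s: "s \<in> S" "c < s" using assms S_down[of b s] by auto
    show "(\<phi> has_real_derivative \<phi>' s) (at s)"
      unfolding \<phi>_def[abs_def] \<phi>'_def using G1_pos[OF s] F_pos[OF s] s
      by (auto intro!: derivative_eq_intros dG1 dG2 dF simp: field_simps power2_eq_square)
    assume "\<phi> s = 0"
    then have "G2 s * F s = (G1 s)^2"
      using G1_pos[OF s] F_pos[OF s] by (simp add: \<phi>_def field_simps power2_eq_square)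
    then show "\<phi>' s > 0" using G3_at_critical[OF s] G1_pos[OF s] by (simp add: \<phi>'_def)
  next
    have "a \<in> S" using assms S_down by auto
    then show "\<phi> a \<ge> 0" using D1_eq[of a] D_pos[of a] assms by (simp add: zero_le_mult_iff)
  qed
  then show ?thesis using D1_eq[of b] D_pos[of b] assms by simp
qed

lemma D1_cont: assumes "c < a" "b \<in> S" shows "continuous_on {a..b} D1"
  unfolding D1_def[abs_def]
  using assms S_down F_pos DERIV_isCont[OF dG2] DERIV_isCont[OF dG1] DERIV_isCont[OF dF]
  by (intro continuous_at_imp_continuous_on ballI continuous_intros) (auto simp: less_imp_neq, fastforce)

lemma D1_neg_near_c: "\<forall>\<^sub>F \<kappa> in at_right c. D1 \<kappa> < 0"
proof -
  have "\<forall>\<^sub>F \<kappa> in at_right c. z \<kappa> > 3/2" "\<forall>\<^sub>F \<kappa> in at_right c. x \<kappa> < 3/2"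
    using order_tendstoD(1)[OF lim_z, of "3/2"] order_tendstoD(2)[OF lim_x, of "3/2"] by auto
  with eventually_S show ?thesis
  proof eventually_elim
    case (elim \<kappa>)
    then have "(\<kappa> - c) * D1 \<kappa> < 0" using D1_zx[of \<kappa>] D_pos[of \<kappa>] by (simp add: mult_less_0_iff)
    then show ?case using elim by (simp add: mult_less_0_iff)
  qed
qed

lemma mean_less_D: assumes "\<kappa> \<in> S" "c < \<kappa>" shows "mean \<kappa> < D \<kappa>"
  using F_less[OF assms(1)] F_pos[OF assms] G1_pos[OF assms]
  by (simp add: mean_def D_def divide_strict_left_mono)

text \<open>\<open>D\<close> cannot decrease forever, because it dominates \<open>mean\<close>, which is unbounded.\<close>
lemma D1_nonneg_somewhere: "\<exists>\<kappa>\<in>S. c < \<kappa> \<and> D1 \<kappa> \<ge> 0"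
proof (rule ccontr)
  assume "\<not> ?thesis"
  then have neg: "D1 \<kappa> < 0" if "\<kappa> \<in> S" "c < \<kappa>" for \<kappa> using that by force
  define a where "a = Xi 1"
  have a: "a \<in> S" "c < a" using Xi_S[of 1] Xi_gt[of 1] by (auto simp: a_def)
  define b where "b = Xi (D a)"
  have b: "b \<in> S" "mean b = D a" using D_pos[OF a] by (auto simp: b_def Xi_S mean_Xi)
  have "a < b" using b mean_less_D[OF a] mean_strict[OF a(1), of b] by (cases a b rule: linorder_cases) auto
  have "D b < D a"
  proof (rule DERIV_neg_imp_decreasing[OF \<open>a < b\<close>])
    fix t assume "a \<le> t" "t \<le> b"
    then show "\<exists>y. (D has_real_derivative y) (at t) \<and> y < 0"
      using dD[of t] neg[of t] S_down[OF b(1), of t] a by auto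
  qed
  then show False using mean_less_D[of b] b a \<open>a < b\<close> by simp
qed

lemma turning_point:
  "\<exists>k. k \<in> S \<and> c < k \<and> D1 k = 0 \<and> (\<forall>\<kappa>. c < \<kappa> \<longrightarrow> \<kappa> < k \<longrightarrow> D1 \<kappa> < 0) \<and>
     (\<forall>\<kappa>\<in>S. k < \<kappa> \<longrightarrow> D1 \<kappa> > 0)"
proof -
  obtain b where b: "b \<in> S" "c < b" "D1 b \<ge> 0" using D1_nonneg_somewhere by blast
  obtain a where a: "c < a" "a < b" "D1 a < 0"
  proof -
    have "\<forall>\<^sub>F \<kappa> in at_right c. c < \<kappa> \<and> \<kappa> < b \<and> D1 \<kappa> < 0"
      using D1_neg_near_c eventually_at_right_less[of c] eventually_at_right_real[OF b(2)]
      by eventually_elim auto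
    then show ?thesis using that eventually_happens[of _ "at_right c"] by fastforce
  qed
  obtain k where k: "a \<le> k" "k \<le> b" "D1 k = 0"
    using IVT'[of D1 a 0 b] a b D1_cont[of a b] by auto
  have kS: "k \<in> S" "c < k" using k a b S_down[of b k] by auto
  have "D1 \<kappa> < 0" if "c < \<kappa>" "\<kappa> < k" for \<kappa>
    using D1_pos_after[of \<kappa> k] that kS k by force
  moreover have "D1 \<kappa> > 0" if "\<kappa> \<in> S" "k < \<kappa>" for \<kappa>
    using D1_pos_after[of k \<kappa>] that kS k by auto
  ultimately show ?thesis using kS k by blast
qed

text \<open>The tilting parameter that corresponds to the minimizer of \<open>\<delta>*\<close>.\<close>
definition kap_check :: real where
  "kap_check = (SOME k. k \<in> S \<and> c < k \<and> D1 k = 0 \<and> (\<forall>\<kappa>. c < \<kappa> \<longrightarrow> \<kappa> < k \<longrightarrow> D1 \<kappa> < 0) \<and>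
     (\<forall>\<kappa>\<in>S. k < \<kappa> \<longrightarrow> D1 \<kappa> > 0))"

lemma kap_check: "kap_check \<in> S" "c < kap_check" "D1 kap_check = 0" "c < \<kappa> \<Longrightarrow> \<kappa> < kap_check \<Longrightarrow> D1 \<kappa> < 0"
   "\<kappa> \<in> S \<Longrightarrow> kap_check < \<kappa> \<Longrightarrow> D1 \<kappa> > 0"
  using someI_ex[OF turning_point] unfolding kap_check_def[symmetric] by blast+

text \<open>
  \<open>T\<close> starts at \<open>1\<close>.  To the left of the turning point \<open>z > x\<close>, and \<open>x \<ge> 1\<close> because \<open>F''\<close> is
  increasing; under these constraints the differential equations for \<open>z\<close>, \<open>x\<close>, \<open>w\<close> force
  \<open>T\<close> to increase wherever it vanishes, so it never reaches zero.
\<close>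
lemma T_pos: assumes s: "c < s" "s < kap_check" shows "T s > 0"
proof -
  obtain a where a: "c < a" "a < s" "T a > 0"
  proof -
    have "\<forall>\<^sub>F \<kappa> in at_right c. T \<kappa> > 0" using order_tendstoD(1)[OF lim_T, of 0] by simp
    then have "\<forall>\<^sub>F \<kappa> in at_right c. c < \<kappa> \<and> \<kappa> < s \<and> T \<kappa> > 0"
      using eventually_at_right_less[of c] eventually_at_right_real[OF s(1)]
      by eventually_elim auto
    then show ?thesis using that eventually_happens[of _ "at_right c"] by fastforce
  qed
  define T' where "T' \<kappa> = (4 * z \<kappa> - 3 * x \<kappa> - 1) * (z \<kappa> * (1 + x \<kappa> - z \<kappa>) / (\<kappa> - c))
      + (w \<kappa> + 1 - 3 * z \<kappa>) * (x \<kappa> * (1 + w \<kappa> - x \<kappa>) / (\<kappa> - c))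
      + x \<kappa> * ((w \<kappa> + (\<kappa> - c)^2 * (G2 \<kappa> * G4 \<kappa> - (G3 \<kappa>)^2) / (G2 \<kappa>)^2) / (\<kappa> - c))" for \<kappa>
  show ?thesis
  proof (rule positive_after_upward_crossings[OF a(2)])
    fix t assume "t \<in> {a..s}"
    then have t: "t \<in> S" "c < t" "t < kap_check" using S_down[OF kap_check(1), of t] a s by auto
    define i where "i = inverse (t - c)"
    \<comment> \<open>\<open>q\<close> is the Cauchy-Schwarz defect in the equation for \<open>w\<close>; only its sign matters.\<close>
    define q where "q = (t - c)^2 * (G2 t * G4 t - (G3 t)^2) / (G2 t)^2"
    have dz': "(z has_real_derivative z t * (1 + x t - z t) * i) (at t)"
      and dx': "(x has_real_derivative x t * (1 + w t - x t) * i) (at t)"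
      and dw': "(w has_real_derivative (w t + q) * i) (at t)"
      using dz[OF t(1,2)] dx[OF t(1,2)] dw[OF t(1,2)] by (simp_all add: i_def q_def divide_inverse)
    have T'_eq: "T' t = (4 * z t - 3 * x t - 1) * (z t * (1 + x t - z t) * i)
        + (w t + 1 - 3 * z t) * (x t * (1 + w t - x t) * i) + x t * ((w t + q) * i)"
      unfolding T'_def q_def[symmetric] by (simp add: i_def divide_inverse)
    show "(T has_real_derivative T' t) (at t)"
      unfolding T_def[abs_def] T'_eq
      by (rule derivative_eq_intros dz' dx' dw' refl)+ (simp add: algebra_simps power2_eq_square)
    assume "T t = 0"
    define d where "d = z t - x t"
    have "D t * (x t - z t) < 0" using D1_zx[OF t(1,2)] kap_check(4)[OF t(2,3)] t
      by (metis diff_gt_0_iff_gt mult_pos_neg)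
    then have d: "d > 0" "z t = x t + d" using D_pos[OF t(1,2)] by (auto simp: d_def mult_less_0_iff)
    have x1: "x t \<ge> 1" using G1_le_xi_G2[OF t(1,2)] G1_pos[OF t(1,2)] by (simp add: x_def)
    have q: "q \<ge> 0" using hankel24[OF t(1)] by (simp add: q_def)
    have "0 < (4 * z t - 3 * x t - 1) * (z t * (1 + x t - z t))
         + x t * (1 + w t - x t) * (w t + 1 - 3 * z t) + x t * w t"
      using crossing_polynomial_positive[OF x1 d(1), of "w t"] \<open>T t = 0\<close> unfolding T_def d(2) by simp
    also have "\<dots> \<le> \<dots> + x t * q" using q x1 by simp
    finally have "0 < i * ((4 * z t - 3 * x t - 1) * (z t * (1 + x t - z t))
         + x t * (1 + w t - x t) * (w t + 1 - 3 * z t) + x t * w t + x t * q)"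
      using t(2) by (simp add: i_def)
    then show "T' t > 0" unfolding T'_eq by (simp add: algebra_simps)
  qed (use a in auto)
qed

lemma xi_D1_strict: assumes "c < a" "a < b" "b < kap_check" shows "(a - c) * D1 a < (b - c) * D1 b"
proof -
  have in_S: "t \<in> S \<and> c < t" if "a \<le> t" "t \<le> b" for t using S_down[OF kap_check(1), of t] assms that by auto
  have "D a * (x a - z a) < D b * (x b - z b)"
  proof (rule DERIV_pos_imp_increasing[OF assms(2)])
    fix t assume t': "a \<le> t" "t \<le> b"
    have t: "t \<in> S" "c < t" using in_S t' by auto
    have "D1 t = D t * (x t - z t) / (t - c)"
      using D1_zx[OF t] t by (metis diff_gt_0_iff_gt less_irrefl nonzero_mult_div_cancel_left)
    then have dD': "(D has_real_derivative D t * (x t - z t) / (t - c)) (at t)" using dD[OF t] by simp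
    have "((\<lambda>t. D t * (x t - z t)) has_real_derivative D t / (t - c) * T t) (at t)"
      unfolding T_def
      by (rule derivative_eq_intros dD' dx[OF t] dz[OF t] refl)+
         (simp add: divide_inverse algebra_simps power2_eq_square)
    moreover have "D t / (t - c) * T t > 0" using T_pos[of t] D_pos[OF t] t t' assms by simp
    ultimately show "\<exists>y. ((\<lambda>t. D t * (x t - z t)) has_real_derivative y) (at t) \<and> y > 0" by blast
  qed
  then show ?thesis using D1_zx in_S[of a] in_S[of b] assms by simp
qed

text \<open>
  Passing from the weight \<open>\<kappa> - c\<close> to \<open>\<kappa>\<close> multiplies by \<open>\<kappa> / (\<kappa> - c)\<close>, which is decreasing since
  \<open>c > 0\<close>.
\<close>
lemma kappa_D1_strict: assumes "c < a" "a < b" "b < kap_check" shows "b * (- D1 b) < a * (- D1 a)"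
proof -
  have "b / (b - c) \<le> a / (a - c)" using assms c_pos by (simp add: field_simps)
  moreover have "(b - c) * (- D1 b) < (a - c) * (- D1 a)" using xi_D1_strict[OF assms] by simp
  moreover have "0 \<le> (b - c) * (- D1 b)"
    using kap_check(4)[of b] assms by (intro mult_nonneg_nonneg) auto
  moreover have "0 < b / (b - c)" using assms c_pos by simp
  ultimately have "(b / (b - c)) * ((b - c) * (- D1 b)) < (a / (a - c)) * ((a - c) * (- D1 a))"
    by (metis mult_le_less_imp_less)
  then show ?thesis using assms by simp
qed

section \<open>The unique maximum in the tilting parameter\<close>

text \<open>
  \<open>eta\<close> is the dual point at which \<open>ln G0\<close> has slope \<open>D \<kappa>\<close>.  Consequently \<open>gap \<kappa>\<close> is the smallest vertical
  distance from the tangent of \<open>ln F\<close> at \<open>\<kappa>\<close> up to the graph of \<open>ln G0\<close>.  \<open>P\<close> is the function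
  \<open>L^\<close> in the variable \<open>\<kappa>\<close>.
\<close>
definition eta :: "real \<Rightarrow> real" where "eta \<kappa> = Xi (D \<kappa>)"
definition gap :: "real \<Rightarrow> real" where
  "gap \<kappa> = ln (G0 (eta \<kappa>)) - eta \<kappa> * D \<kappa> - ln (F \<kappa>) + \<kappa> * D \<kappa>"
definition P :: "real \<Rightarrow> real" where
  "P \<kappa> = F \<kappa> * exp (- (\<kappa> * D \<kappa>)) - G0 (eta \<kappa>) * exp (- (eta \<kappa> * D \<kappa>))"

lemma eta_S: "\<kappa> \<in> S \<Longrightarrow> c < \<kappa> \<Longrightarrow> eta \<kappa> \<in> S"
  unfolding eta_def using D_pos by (intro Xi_S) (simp add: less_imp_le)

lemma mean_eta: "\<kappa> \<in> S \<Longrightarrow> c < \<kappa> \<Longrightarrow> mean (eta \<kappa>) = D \<kappa>"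
  unfolding eta_def using D_pos by (intro mean_Xi) (simp add: less_imp_le)

lemma eta_gt: assumes "\<kappa> \<in> S" "c < \<kappa>" shows "\<kappa> < eta \<kappa>"
  using mean_less_D[OF assms] mean_eta[OF assms] mean_strict[OF assms(1), of "eta \<kappa>"]
  by (cases \<kappa> "eta \<kappa>" rule: linorder_cases) auto

lemma deta: assumes "\<kappa> \<in> S" "c < \<kappa>"
  shows "(eta has_real_derivative inverse (var (eta \<kappa>)) * D1 \<kappa>) (at \<kappa>)"
  unfolding eta_def[abs_def] using DERIV_chain2[OF dXi[OF D_pos[OF assms]] dD[OF assms]] .

text \<open>
  Envelope principle: the contribution of \<open>eta'\<close> vanishes because \<open>ln G0\<close> has slope \<open>D\<close> at \<open>eta\<close>,
  and the contribution of the base point because \<open>ln F\<close> has slope \<open>D\<close> at \<open>\<kappa>\<close>.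
\<close>
lemma dgap: assumes "\<kappa> \<in> S" "c < \<kappa>"
  shows "(gap has_real_derivative (\<kappa> - eta \<kappa>) * D1 \<kappa>) (at \<kappa>)"
proof -
  have pos: "G0 (eta \<kappa>) > 0" "F \<kappa> > 0" using G0_pos[OF eta_S[OF assms]] F_pos[OF assms] by auto
  have dG0_eta: "((\<lambda>\<kappa>. G0 (eta \<kappa>)) has_real_derivative G1 (eta \<kappa>) * (inverse (var (eta \<kappa>)) * D1 \<kappa>)) (at \<kappa>)"
    using DERIV_chain2[OF dG0[OF eta_S[OF assms]] deta[OF assms]] .
  have "G1 (eta \<kappa>) / G0 (eta \<kappa>) = D \<kappa>" "G1 \<kappa> / F \<kappa> = D \<kappa>"
    using mean_eta[OF assms] by (auto simp: mean_def D_def)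
  then have G1s: "G1 (eta \<kappa>) = D \<kappa> * G0 (eta \<kappa>)" "G1 \<kappa> = D \<kappa> * F \<kappa>"
    using pos by (auto simp: field_simps)
  define u where "u = inverse (var (eta \<kappa>)) * D1 \<kappa>"
  show ?thesis unfolding gap_def[abs_def]
    by (rule derivative_eq_intros dG0_eta[folded u_def] deta[OF assms, folded u_def]
          dD[OF assms] dF[OF assms(1)] pos refl)+
       (use pos in \<open>simp add: G1s algebra_simps\<close>)
qed

lemma P_eq: assumes "\<kappa> \<in> S" "c < \<kappa>"
  shows "P \<kappa> = F \<kappa> * exp (- (\<kappa> * D \<kappa>)) * (1 - exp (gap \<kappa>))"
proof -
  have pos: "G0 (eta \<kappa>) > 0" "F \<kappa> > 0" using G0_pos[OF eta_S[OF assms]] F_pos[OF assms] by auto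
  have "exp (gap \<kappa>) = G0 (eta \<kappa>) * exp (- (eta \<kappa> * D \<kappa>)) / F \<kappa> * exp (\<kappa> * D \<kappa>)"
    unfolding gap_def using pos by (simp add: exp_add exp_diff exp_minus field_simps)
  then show ?thesis using pos by (simp add: P_def exp_minus field_simps)
qed

lemma dP: assumes "\<kappa> \<in> S" "c < \<kappa>"
  shows "(P has_real_derivative D1 \<kappa> * F \<kappa> * exp (- (\<kappa> * D \<kappa>)) * (eta \<kappa> * exp (gap \<kappa>) - \<kappa>)) (at \<kappa>)"
proof -
  have pos: "F \<kappa> > 0" using F_pos[OF assms] by auto
  have G1: "G1 \<kappa> = D \<kappa> * F \<kappa>" using pos by (simp add: D_def)
  have d: "((\<lambda>\<kappa>. F \<kappa> * exp (- (\<kappa> * D \<kappa>)) * (1 - exp (gap \<kappa>))) has_real_derivative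
      D1 \<kappa> * F \<kappa> * exp (- (\<kappa> * D \<kappa>)) * (eta \<kappa> * exp (gap \<kappa>) - \<kappa>)) (at \<kappa>)"
    by (rule derivative_eq_intros dgap[OF assms] dD[OF assms] dF[OF assms(1)] refl)+
       (simp add: G1 algebra_simps)
  have "\<forall>\<^sub>F t in nhds \<kappa>. t \<in> S \<and> c < t"
  proof -
    have "eta \<kappa> \<in> S" "\<kappa> < eta \<kappa>" using eta_S eta_gt assms by auto
    then have "\<And>t. t \<in> {c<..<eta \<kappa>} \<Longrightarrow> t \<in> S \<and> c < t" using S_down[of "eta \<kappa>"] by auto
    then show ?thesis using \<open>\<kappa> < eta \<kappa>\<close> assms
      by (intro eventually_nhds[THEN iffD2] exI[of _ "{c<..<eta \<kappa>}"]) auto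
  qed
  then have "\<forall>\<^sub>F t in nhds \<kappa>. P t = F t * exp (- (t * D t)) * (1 - exp (gap t))"
    by eventually_elim (use P_eq in auto)
  then show ?thesis using d by (subst DERIV_cong_ev[OF refl _ refl]) auto
qed

lemma D_increasing: assumes "kap_check \<le> a" "a < b" "b \<in> S" shows "D a < D b"
proof (rule DERIV_pos_imp_increasing_open[OF assms(2)])
  fix t assume "a < t" "t < b"
  then show "\<exists>y. (D has_real_derivative y) (at t) \<and> y > 0"
    using dD[of t] kap_check(5)[of t] S_down[OF assms(3), of t] kap_check(2) assms by auto
next
  show "continuous_on {a..b} D"
  proof (intro continuous_at_imp_continuous_on ballI)
    fix t assume "t \<in> {a..b}"
    then have "t \<in> S" "c < t" using S_down[OF assms(3), of t] assms kap_check(2) by auto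
    then show "isCont D t" using DERIV_isCont dD by blast
  qed
qed

lemma D_decreasing: assumes "c < a" "a < b" "b \<le> kap_check" shows "D b < D a"
proof (rule DERIV_neg_imp_decreasing_open[OF assms(2)])
  fix t assume "a < t" "t < b"
  then show "\<exists>y. (D has_real_derivative y) (at t) \<and> y < 0"
    using dD[of t] kap_check(4)[of t] S_down[OF kap_check(1), of t] assms by auto
next
  show "continuous_on {a..b} D"
  proof (intro continuous_at_imp_continuous_on ballI)
    fix t assume "t \<in> {a..b}"
    then have "t \<in> S" "c < t" using S_down[OF kap_check(1), of t] assms by auto
    then show "isCont D t" using DERIV_isCont dD by blast
  qed
qed

lemma D_minimum: assumes "\<kappa> \<in> S" "c < \<kappa>" "\<kappa> \<noteq> kap_check" shows "D kap_check < D \<kappa>"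
  using D_increasing[of kap_check \<kappa>] D_decreasing[of \<kappa> kap_check] assms by (cases \<kappa> kap_check rule: linorder_cases) auto

text \<open>
  Beyond the turning point \<open>ln F\<close> is convex, so \<open>ln F\<close>, and with it the larger function \<open>ln G0\<close>,
  lies above the tangent.
\<close>
lemma gap_pos_after: assumes "\<kappa> \<in> S" "kap_check \<le> \<kappa>" shows "gap \<kappa> > 0"
proof -
  have k: "c < \<kappa>" using kap_check(2) assms by simp
  have e: "\<kappa> < eta \<kappa>" "eta \<kappa> \<in> S" using eta_gt eta_S assms k by auto
  have "\<exists>t. \<kappa> < t \<and> t < eta \<kappa> \<and> ln (F (eta \<kappa>)) - ln (F \<kappa>) = (eta \<kappa> - \<kappa>) * D t"
  proof (rule MVT2[OF e(1)])
    fix t assume "\<kappa> \<le> t" "t \<le> eta \<kappa>"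
    then have t: "t \<in> S" "c < t" using S_down[OF e(2), of t] k by auto
    show "((\<lambda>t. ln (F t)) has_real_derivative D t) (at t)"
      using F_pos[OF t] by (auto intro!: derivative_eq_intros dF t simp: D_def)
  qed
  then obtain t where t: "\<kappa> < t" "t < eta \<kappa>" "ln (F (eta \<kappa>)) - ln (F \<kappa>) = (eta \<kappa> - \<kappa>) * D t" by blast
  have "D \<kappa> < D t" using D_increasing[of \<kappa> t] assms t S_down[OF e(2), of t] by auto
  then have "(eta \<kappa> - \<kappa>) * D \<kappa> < (eta \<kappa> - \<kappa>) * D t" using e by simp
  moreover have "ln (F (eta \<kappa>)) < ln (G0 (eta \<kappa>))"
    using F_less[OF e(2)] F_pos[of "eta \<kappa>"] e k by simp
  ultimately show ?thesis using t(3) by (simp add: gap_def algebra_simps)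
qed

text \<open>
  As \<open>\<kappa>\<close> decreases to \<open>c\<close> the base point \<open>ln F\<close> falls only like \<open>2 ln (\<kappa> - c)\<close>, whereas the slope
  \<open>D\<close> is at least \<open>1 / (\<kappa> - c)\<close>.  So the tangent eventually passes above the graph of \<open>ln G0\<close> at a fixed
  point \<open>h > c\<close>.
\<close>
lemma gap_neg_near_c: "\<forall>\<^sub>F \<kappa> in at_right c. gap \<kappa> < 0"
proof -
  define h where "h = Xi 1"
  have h: "h \<in> S" "c < h" using Xi_S[of 1] Xi_gt[of 1] by (auto simp: h_def)
  \<comment> \<open>Half the limit of \<open>F \<kappa> / (\<kappa> - c)\<^sup>2\<close>.\<close>
  define q where "q = G2 c / 4"
  have q: "q > 0" using G2_pos[OF c_S] by (simp add: q_def)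
  \<comment> \<open>\<open>eta\<close> minimizes \<open>ln G0 - D \<kappa> \<sqdot> id\<close>, so it can be compared with \<open>h\<close>.\<close>
  have tangent: "ln (G0 (eta \<kappa>)) - eta \<kappa> * D \<kappa> \<le> ln (G0 h) - h * D \<kappa>" if "\<kappa> \<in> S" "c < \<kappa>" for \<kappa>
  proof -
    define f where "f t = ln (G0 t) - t * D \<kappa>" for t
    have df: "(f has_real_derivative mean t - D \<kappa>) (at t)" if "t \<in> S" for t
      unfolding f_def[abs_def] mean_def using G0_pos[OF that]
      by (auto intro!: derivative_eq_intros dG0 that)
    have eS: "eta \<kappa> \<in> S" and eK: "mean (eta \<kappa>) = D \<kappa>" using eta_S mean_eta that by auto
    consider "h = eta \<kappa>" | "h < eta \<kappa>" | "eta \<kappa> < h" by linarith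
    then have "f (eta \<kappa>) \<le> f h"
    proof cases
      case 2
      show ?thesis
      proof (rule DERIV_nonpos_imp_nonincreasing[where f = f])
        fix t assume t: "h \<le> t" "t \<le> eta \<kappa>"
        then have "t \<in> S" "mean t \<le> D \<kappa>"
          using S_down[OF eS, of t] mean_strict[OF eS, of t] eK by (cases "t = eta \<kappa>"; simp)+
        then show "\<exists>y. (f has_real_derivative y) (at t) \<and> y \<le> 0" using df[of t] by force
      qed (use 2 in simp)
    next
      case 3
      show ?thesis
      proof (rule DERIV_nonneg_imp_nondecreasing[where f = f])
        fix t assume t: "eta \<kappa> \<le> t" "t \<le> h"
        then have "t \<in> S" "mean t \<ge> D \<kappa>"
          using S_down[OF h(1), of t] mean_strict[of t "eta \<kappa>"] eK by (cases "t = eta \<kappa>"; simp)+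
        then show "\<exists>y. (f has_real_derivative y) (at t) \<and> 0 \<le> y" using df[of t] by force
      qed (use 3 in simp)
    qed simp
    then show ?thesis by (simp add: f_def)
  qed
  have ev_F: "\<forall>\<^sub>F \<kappa> in at_right c. q < F \<kappa> / (\<kappa> - c)^2"
    using order_tendstoD(1)[OF lim_F, of q] G2_pos[OF c_S] by (simp add: q_def)
  have ev_z: "\<forall>\<^sub>F \<kappa> in at_right c. 1 < z \<kappa>" using order_tendstoD(1)[OF lim_z, of 1] by simp
  have "\<forall>\<^sub>F u in at_right (0::real). ln (G0 h) - ln q - 2 * ln u - (h - c - u) / u < 0"
    using h by real_asymp
  then have ev_u: "\<forall>\<^sub>F \<kappa> in at_right c. ln (G0 h) - ln q - 2 * ln (\<kappa> - c) - (h - c - (\<kappa> - c)) / (\<kappa> - c) < 0"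
    unfolding eventually_at_right_to_0[of _ c] by simp
  have ev_h: "\<forall>\<^sub>F \<kappa> in at_right c. \<kappa> < h" using eventually_at_right_real[OF h(2)] by eventually_elim auto
  show ?thesis using eventually_S ev_F ev_z ev_u ev_h
  proof eventually_elim
    case (elim \<kappa>)
    then have xi: "\<kappa> - c > 0" by simp
    have "q * (\<kappa> - c)^2 < F \<kappa>" using elim xi by (simp add: pos_less_divide_eq)
    then have "ln (q * (\<kappa> - c)^2) < ln (F \<kappa>)" using q xi F_pos[of \<kappa>] elim by (subst ln_less_cancel_iff) auto
    then have "ln q + 2 * ln (\<kappa> - c) < ln (F \<kappa>)"
      using q xi by (simp add: ln_mult ln_realpow)
    moreover have "1 / (\<kappa> - c) \<le> D \<kappa>"
      using elim xi by (simp add: z_def D_def pos_divide_le_eq mult.commute)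
    then have "(h - \<kappa>) * (1 / (\<kappa> - c)) \<le> (h - \<kappa>) * D \<kappa>" using elim by (intro mult_left_mono) auto
    ultimately show ?case using tangent[of \<kappa>] elim by (simp add: gap_def algebra_simps)
  qed
qed

lemma gap_strict: assumes "c < a" "a < b" "b \<le> kap_check" shows "gap a < gap b"
proof (rule DERIV_pos_imp_increasing_open[OF assms(2)])
  fix t assume "a < t" "t < b"
  then have t: "t \<in> S" "c < t" "t < kap_check" using S_down[OF kap_check(1), of t] assms by auto
  then show "\<exists>y. (gap has_real_derivative y) (at t) \<and> y > 0"
    using dgap[OF t(1,2)] eta_gt[OF t(1,2)] kap_check(4)[OF t(2,3)]
    by (intro exI[of _ "(t - eta t) * D1 t"]) (auto simp: mult_neg_neg)
next
  show "continuous_on {a..b} gap"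
  proof (intro continuous_at_imp_continuous_on ballI)
    fix t assume "t \<in> {a..b}"
    then have "t \<in> S" "c < t" using S_down[OF kap_check(1), of t] assms by auto
    then show "isCont gap t" using DERIV_isCont dgap by blast
  qed
qed

lemma gap_zero: "\<exists>k. c < k \<and> k < kap_check \<and> gap k = 0"
proof -
  have "\<forall>\<^sub>F \<kappa> in at_right c. c < \<kappa> \<and> \<kappa> < kap_check \<and> gap \<kappa> < 0"
    using gap_neg_near_c eventually_at_right_less[of c] eventually_at_right_real[OF kap_check(2)]
    by eventually_elim auto
  then obtain a where a: "c < a" "a < kap_check" "gap a < 0"
    using eventually_happens[of _ "at_right c"] by fastforce
  have cont: "continuous_on {a..kap_check} gap"
  proof (intro continuous_at_imp_continuous_on ballI)
    fix t assume "t \<in> {a..kap_check}"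
    then have "t \<in> S" "c < t" using S_down[OF kap_check(1), of t] a by auto
    then show "isCont gap t" using DERIV_isCont dgap by blast
  qed
  obtain k where k: "a \<le> k" "k \<le> kap_check" "gap k = 0"
    using IVT'[of gap a 0 kap_check] cont a gap_pos_after[OF kap_check(1)] by auto
  then show ?thesis using a gap_pos_after[OF kap_check(1)] by (intro exI[of _ k]) (auto simp: less_le)
qed

text \<open>The tilting parameter at which \<open>A + B^ = 1\<close>.\<close>
definition kap_hat :: real where "kap_hat = (SOME k. c < k \<and> k < kap_check \<and> gap k = 0)"

lemma kap_hat: "c < kap_hat" "kap_hat < kap_check" "gap kap_hat = 0" "kap_hat \<in> S"
  using someI_ex[OF gap_zero] S_down[OF kap_check(1), of kap_hat] unfolding kap_hat_def[symmetric] by auto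

lemma gap_neg: "c < \<kappa> \<Longrightarrow> \<kappa> < kap_hat \<Longrightarrow> gap \<kappa> < 0"
  using gap_strict[of \<kappa> kap_hat] kap_hat by simp

lemma gap_pos: "\<kappa> \<in> S \<Longrightarrow> kap_hat < \<kappa> \<Longrightarrow> gap \<kappa> > 0"
  using gap_strict[of kap_hat \<kappa>] kap_hat gap_pos_after[of \<kappa>] by (cases "\<kappa> \<le> kap_check") auto

lemma sgn_P: assumes "\<kappa> \<in> S" "c < \<kappa>" shows "sgn (P \<kappa>) = - sgn (gap \<kappa>)"
proof -
  have "sgn (P \<kappa>) = sgn (1 - exp (gap \<kappa>))"
    unfolding P_eq[OF assms] using F_pos[OF assms] by (simp add: sgn_mult)
  then show ?thesis by (auto simp: sgn_if)
qed

text \<open>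
  The sign of \<open>rho\<close> decides the sign of the derivative of \<open>P\<close> (\<open>P_deriv_rho\<close>), and the sign of
  \<open>Omega\<close> that of the derivative of \<open>rho\<close> (\<open>drho\<close>).
\<close>
definition rho :: "real \<Rightarrow> real" where "rho \<kappa> = ln (eta \<kappa>) - ln \<kappa> + gap \<kappa>"
definition Omega :: "real \<Rightarrow> real" where
  "Omega \<kappa> = (eta \<kappa> - \<kappa>) - 1 / (var (eta \<kappa>) * eta \<kappa>) - 1 / (\<kappa> * (- D1 \<kappa>))"

lemma drho: assumes "c < \<kappa>" "\<kappa> < kap_check" shows "(rho has_real_derivative - D1 \<kappa> * Omega \<kappa>) (at \<kappa>)"
proof -
  have \<kappa>: "\<kappa> \<in> S" using S_down[OF kap_check(1)] assms by simp
  have pos: "\<kappa> > 0" "eta \<kappa> > 0" "var (eta \<kappa>) > 0" "D1 \<kappa> < 0"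
    using c_pos assms eta_gt[OF \<kappa>] var_pos[OF eta_S[OF \<kappa>]] kap_check(4) by auto
  show ?thesis unfolding rho_def[abs_def] Omega_def
    by (rule derivative_eq_intros deta[OF \<kappa> assms(1)] dgap[OF \<kappa> assms(1)] pos refl)+
       (use pos in \<open>simp add: field_simps\<close>)
qed

text \<open>
  Each of the three terms decreases: \<open>eta\<close> decreases with \<open>D\<close>; the product \<open>var \<sqdot> id\<close> is
  increasing, hence decreasing along \<open>eta\<close>; and the last term is \<open>kappa_D1_strict\<close>.
\<close>
lemma Omega_strict: assumes "c < a" "a < b" "b < kap_check" shows "Omega b < Omega a"
proof -
  have S: "a \<in> S" "b \<in> S" "c < b" using S_down[OF kap_check(1)] assms by auto
  have "D b < D a" using D_decreasing assms by simp
  then have "eta b < eta a" unfolding eta_def using D_pos[OF S(2,3)] by (intro Xi_strict) auto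
  have eb: "b < eta b" "eta a \<in> S" "eta b \<in> S" using eta_gt eta_S S assms by auto
  have pos: "0 < var (eta b)" "0 < eta b" using var_pos eb c_pos S by auto
  have "var (eta b) * eta b \<le> var (eta a) * eta a"
    using \<open>eta b < eta a\<close> var_mono[of "eta a" "eta b"] eb pos S by (intro mult_mono) auto
  then have "1 / (var (eta a) * eta a) \<le> 1 / (var (eta b) * eta b)"
    using mult_pos_pos[OF pos] by (auto intro: frac_le)
  moreover have "0 < b * (- D1 b)" using kap_check(4)[of b] assms S c_pos by (intro mult_pos_pos) auto
  then have "1 / (a * (- D1 a)) \<le> 1 / (b * (- D1 b))"
    using kappa_D1_strict[OF assms] by (intro frac_le) auto
  ultimately show ?thesis using \<open>eta b < eta a\<close> assms unfolding Omega_def by linarith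
qed

lemma rho_kap_hat: "rho kap_hat > 0"
  using eta_gt[OF kap_hat(4,1)] kap_hat(1,3) c_pos by (simp add: rho_def)

lemma rho_cont: assumes "c < a" "b < kap_check" shows "continuous_on {a..b} rho"
proof (intro continuous_at_imp_continuous_on ballI)
  fix t assume "t \<in> {a..b}"
  then have "c < t" "t < kap_check" using assms by auto
  then show "isCont rho t" by (rule DERIV_isCont[OF drho])
qed

text \<open>
  \<open>rho\<close> rises and then falls.  Up to \<open>b\<close> either it is still rising, so it exceeds \<open>rho a\<close>, or from
  \<open>b\<close> on it only falls, so it exceeds its positive value at \<open>kap_hat\<close>.
\<close>
lemma rho_stays_positive: assumes "c < a" "a < b" "b \<le> kap_hat" "rho a \<ge> 0" shows "rho b > 0"
proof (cases "Omega b \<ge> 0")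
  case True
  have "rho a < rho b"
  proof (rule DERIV_pos_imp_increasing_open[OF assms(2)])
    fix t assume t: "a < t" "t < b"
    then have t': "c < t" "t < kap_check" "b < kap_check" using assms kap_hat(2) by auto
    then have "Omega t > 0" using Omega_strict[of t b] t True by simp
    then show "\<exists>y. (rho has_real_derivative y) (at t) \<and> y > 0"
      using drho[OF t'(1,2)] kap_check(4)[OF t'(1,2)]
      by (intro exI[of _ "- D1 t * Omega t"]) (auto intro: mult_neg_pos)
  next
    show "continuous_on {a..b} rho"
      using assms kap_hat(2) by (intro rho_cont) auto
  qed
  then show ?thesis using assms by simp
next
  case False
  have "rho b \<ge> rho kap_hat"
  proof (rule DERIV_nonpos_imp_nonincreasing[where f = rho])
    fix t assume t: "b \<le> t" "t \<le> kap_hat"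
    then have t': "c < t" "t < kap_check" using assms kap_hat(2) by auto
    then have "Omega t \<le> 0" using Omega_strict[of b t] t False assms by (cases "t = b") auto
    then have "- D1 t * Omega t \<le> 0" using kap_check(4)[OF t'] by (intro mult_nonneg_nonpos) auto
    then show "\<exists>y. (rho has_real_derivative y) (at t) \<and> y \<le> 0" using drho[OF t'] by blast
  qed (use assms in simp)
  then show ?thesis using rho_kap_hat by simp
qed

lemma P_deriv_rho: assumes "c < \<kappa>" "\<kappa> \<in> S"
  shows "(P has_real_derivative D1 \<kappa> * (F \<kappa> * exp (- (\<kappa> * D \<kappa>)) * \<kappa> * (exp (rho \<kappa>) - 1))) (at \<kappa>)"
proof -
  have "\<kappa> > 0" "eta \<kappa> > 0" using eta_gt[OF assms(2,1)] c_pos assms by auto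
  then have "eta \<kappa> * exp (gap \<kappa>) - \<kappa> = \<kappa> * (exp (rho \<kappa>) - 1)"
    by (simp add: rho_def exp_add exp_diff field_simps)
  then show ?thesis using dP[OF assms(2,1)] by (simp add: mult.assoc)
qed

text \<open>
  Otherwise \<open>P\<close> would be nonincreasing on \<open>(c, kap_hat)\<close>; but it is positive there and squeezed
  to \<open>0\<close> at \<open>c\<close> by \<open>P \<le> F\<close>.
\<close>
lemma rho_neg_somewhere: "\<exists>\<kappa>. c < \<kappa> \<and> \<kappa> < kap_hat \<and> rho \<kappa> < 0"
proof (rule ccontr)
  assume "\<not> ?thesis"
  then have nonneg: "rho \<kappa> \<ge> 0" if "c < \<kappa>" "\<kappa> < kap_hat" for \<kappa> using that by force
  define a where "a = (c + kap_hat) / 2"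
  have a: "c < a" "a < kap_hat" "a \<in> S" using kap_hat(1) S_down[OF kap_hat(4), of a] by (auto simp: a_def)
  have "P a > 0" using sgn_P[OF a(3,1)] gap_neg[OF a(1,2)] by (simp add: sgn_if split: if_splits)
  have "P a \<le> F \<kappa>" if \<kappa>: "c < \<kappa>" "\<kappa> < a" for \<kappa>
  proof -
    have kS: "\<kappa> \<in> S" using S_down[OF a(3)] \<kappa> by simp
    have "P a \<le> P \<kappa>"
    proof (rule DERIV_nonpos_imp_nonincreasing[where f = P])
      fix t assume "\<kappa> \<le> t" "t \<le> a"
      then have t: "c < t" "t < kap_hat" "t < kap_check" "t \<in> S" using \<kappa> a kap_hat(2) S_down[OF a(3), of t] by auto
      have "F t * exp (- (t * D t)) * t * (exp (rho t) - 1) \<ge> 0"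
        using F_pos[OF t(4,1)] nonneg[OF t(1,2)] t c_pos by (intro mult_nonneg_nonneg) auto
      then show "\<exists>y. (P has_real_derivative y) (at t) \<and> y \<le> 0"
        using P_deriv_rho[OF t(1,4)] kap_check(4)[OF t(1,3)]
        by (meson less_imp_le mult_nonpos_nonneg)
    qed (use \<kappa> in simp)
    also have "P \<kappa> \<le> F \<kappa> * exp (- (\<kappa> * D \<kappa>))"
      using G0_pos[OF eta_S[OF kS \<kappa>(1)]] by (simp add: P_def)
    also have "\<dots> \<le> F \<kappa> * 1"
      using F_pos[OF kS \<kappa>(1)] D_pos[OF kS \<kappa>(1)] \<kappa> c_pos by (intro mult_left_mono) auto
    finally show ?thesis by simp
  qed
  then have "\<forall>\<^sub>F \<kappa> in at_right c. P a \<le> F \<kappa>"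
    using a(1) unfolding eventually_at_right_field by (intro exI[of _ a]) auto
  moreover have "(F \<longlongrightarrow> 0) (at_right c)" using cont_c[OF dF[OF c_S]] F_c by simp
  ultimately have "P a \<le> 0" by (intro tendsto_lowerbound[where F = "at_right c" and f = F]) auto
  then show False using \<open>P a > 0\<close> by simp
qed

text \<open>
  The zero of \<open>rho\<close> separates the region where \<open>P\<close> increases from the region where it decreases, up to
  \<open>kap_hat\<close>.  Beyond \<open>kap_hat\<close> the values of \<open>P\<close> are negative, whereas the maximal value is positive.
\<close>
theorem unique_maximum:
  "\<exists>ks. c < ks \<and> ks < kap_hat \<and> (\<forall>\<kappa>\<in>S. c < \<kappa> \<longrightarrow> \<kappa> \<noteq> ks \<longrightarrow> P \<kappa> < P ks)"
proof -
  obtain a where a: "c < a" "a < kap_hat" "rho a < 0" using rho_neg_somewhere by blast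
  have "continuous_on {a..kap_hat} rho"
    using a kap_hat(2) by (intro rho_cont)
  then obtain k where k: "a \<le> k" "k \<le> kap_hat" "rho k = 0"
    using IVT'[of rho a 0 kap_hat] a rho_kap_hat by auto
  have k': "c < k" "k < kap_hat" "k \<in> S" using k a rho_kap_hat S_down[OF kap_hat(4), of k] by (auto simp: less_le)
  have P_cont: "continuous_on {u..u'} P" if "c < u" "u' \<le> kap_hat" for u u'
  proof (intro continuous_at_imp_continuous_on ballI)
    fix t assume "t \<in> {u..u'}"
    then have "t \<in> S" "c < t" using S_down[OF kap_hat(4), of t] that by auto
    then show "isCont P t" using DERIV_isCont dP by blast
  qed
  have up: "P \<kappa> < P k" if \<kappa>: "c < \<kappa>" "\<kappa> < k" for \<kappa>
  proof (rule DERIV_pos_imp_increasing_open[OF \<kappa>(2)])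
    fix t assume t: "\<kappa> < t" "t < k"
    then have t': "c < t" "t < kap_check" "t \<in> S" using \<kappa> k' kap_hat S_down[OF kap_hat(4), of t] by auto
    have "rho t < 0" using rho_stays_positive[of t k] t t' k k' by force
    then have "F t * exp (- (t * D t)) * t * (exp (rho t) - 1) < 0"
      using F_pos[OF t'(3,1)] t' c_pos by (intro mult_pos_neg mult_pos_pos) auto
    then show "\<exists>y. (P has_real_derivative y) (at t) \<and> y > 0"
      using P_deriv_rho[OF t'(1,3)] kap_check(4)[OF t'(1,2)] mult_neg_neg by blast
  qed (use P_cont \<kappa> k' in auto)
  have down: "P \<kappa> < P k" if \<kappa>: "k < \<kappa>" "\<kappa> \<le> kap_hat" for \<kappa>
  proof (rule DERIV_neg_imp_decreasing_open[OF \<kappa>(1)])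
    fix t assume t: "k < t" "t < \<kappa>"
    then have t': "c < t" "t < kap_check" "t \<in> S" using \<kappa> k' kap_hat S_down[OF kap_hat(4), of t] by auto
    have "rho t > 0" using rho_stays_positive[of k t] t \<kappa> k k' by force
    then have "F t * exp (- (t * D t)) * t * (exp (rho t) - 1) > 0"
      using F_pos[OF t'(3,1)] t' c_pos by (intro mult_pos_pos) auto
    then show "\<exists>y. (P has_real_derivative y) (at t) \<and> y < 0"
      using P_deriv_rho[OF t'(1,3)] kap_check(4)[OF t'(1,2)] mult_neg_pos by blast
  qed (use P_cont \<kappa> k' in auto)
  have "P k > 0" using sgn_P[OF k'(3,1)] gap_neg[OF k'(1,2)] by (simp add: sgn_if split: if_splits)
  moreover have "P \<kappa> < 0" if "\<kappa> \<in> S" "kap_hat < \<kappa>" for \<kappa>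
    using sgn_P[of \<kappa>] gap_pos[OF that] that kap_hat(1) by (simp add: sgn_if split: if_splits)
  ultimately have "P \<kappa> < P k" if "\<kappa> \<in> S" "c < \<kappa>" "\<kappa> \<noteq> k" for \<kappa>
    using up[of \<kappa>] down[of \<kappa>] that by (cases "\<kappa> \<le> kap_hat") (fastforce simp: not_le)+
  then show ?thesis using k' by blast
qed

end

section \<open>Exponential moments, tilting and the rate function\<close>

lemma power_le_exp_abs:
  fixes z :: real
  assumes "r > 0"
  shows "\<bar>z\<bar> ^ k \<le> fact k / r ^ k * (exp (r * z) + exp (- (r * z)))"
proof -
  have "(r * \<bar>z\<bar>) ^ k / fact k \<le> exp (r * \<bar>z\<bar>)"
  proof -
    have "(\<Sum>n\<in>{k}. (r * \<bar>z\<bar>) ^ n /\<^sub>R fact n) \<le> (\<Sum>n. (r * \<bar>z\<bar>) ^ n /\<^sub>R fact n)"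
      using assms by (intro sum_le_suminf summable_exp_generic) (auto intro!: divide_nonneg_nonneg simp: divide_inverse)
    then show ?thesis by (simp add: exp_def divide_inverse mult.commute)
  qed
  moreover have "exp (r * \<bar>z\<bar>) \<le> exp (r * z) + exp (- (r * z))"
    by (cases "z \<ge> 0") (auto simp: abs_if)
  ultimately have "(r * \<bar>z\<bar>) ^ k / fact k \<le> exp (r * z) + exp (- (r * z))" by simp
  then show ?thesis using assms by (simp add: power_mult_distrib field_simps)
qed

lemma exp_remainder_bound:
  fixes u :: real shows "\<bar>exp u - 1 - u\<bar> \<le> u^2 * exp \<bar>u\<bar>"
proof -
  have up: "exp u - 1 \<le> u * exp u"
  proof -
    have "1 + (- u) \<le> exp (- u)" by (rule exp_ge_add_one_self)
    then have "(1 - u) * exp u \<le> exp (- u) * exp u" by (intro mult_right_mono) auto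
    then show ?thesis by (simp add: exp_minus algebra_simps)
  qed
  have lo: "1 + u \<le> exp u" by (rule exp_ge_add_one_self)
  have "\<bar>exp u - 1\<bar> \<le> \<bar>u\<bar> * exp \<bar>u\<bar>"
  proof (cases "u \<ge> 0")
    case False
    have "\<bar>u\<bar> * 1 \<le> \<bar>u\<bar> * exp \<bar>u\<bar>" by (intro mult_left_mono) auto
    moreover have "\<bar>exp u - 1\<bar> \<le> \<bar>u\<bar>" using False lo exp_le_one_iff[of u] by linarith
    ultimately show ?thesis by linarith
  qed (use up in simp)
  have "\<bar>exp u - 1 - u\<bar> = exp u - 1 - u" using lo by linarith
  also have "\<dots> \<le> u * (exp u - 1)" using up by (simp add: algebra_simps)
  also have "\<dots> \<le> \<bar>u\<bar> * \<bar>exp u - 1\<bar>" by (metis abs_ge_self abs_mult)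
  also have "\<dots> \<le> \<bar>u\<bar> * (\<bar>u\<bar> * exp \<bar>u\<bar>)" using \<open>\<bar>exp u - 1\<bar> \<le> _\<close> by (intro mult_left_mono) auto
  finally show ?thesis by (simp add: power2_eq_square mult.assoc flip: abs_mult)
qed

text \<open>
  \<open>S\<close> is a down-closed set of parameters with finite exponential moments and without a largest
  element.  The last property leaves room on the right of each parameter, which pays for polynomial
  factors and for difference quotients.
\<close>
locale exponential_tail_law = prob_space N for N :: "real measure" +
  fixes S :: "real set"
  assumes sets_N: "sets N = sets borel"
    and S_down: "\<And>\<kappa> \<kappa>'. \<kappa> \<in> S \<Longrightarrow> \<kappa>' \<le> \<kappa> \<Longrightarrow> \<kappa>' \<in> S"
    and S_right: "\<And>\<kappa>. \<kappa> \<in> S \<Longrightarrow> \<exists>\<kappa>'>\<kappa>. \<kappa>' \<in> S"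
    and exp_integrable: "\<And>\<kappa>. \<kappa> \<in> S \<Longrightarrow> integrable N (\<lambda>t. exp (\<kappa> * t))"
begin

lemma measurable_N: "f \<in> borel_measurable borel \<Longrightarrow> f \<in> borel_measurable N"
  by (simp add: measurable_cong_sets[OF sets_N refl])

definition moment :: "real \<Rightarrow> nat \<Rightarrow> real \<Rightarrow> real" where
  "moment y k \<kappa> = (\<integral>t. (t - y) ^ k * exp (\<kappa> * (t - y)) \<partial>N)"

lemma shifted_exp_integrable: "\<kappa> \<in> S \<Longrightarrow> integrable N (\<lambda>t. exp (\<kappa> * (t - y)))"
proof -
  assume "\<kappa> \<in> S"
  then have "integrable N (\<lambda>t. exp (- \<kappa> * y) * exp (\<kappa> * t))" using exp_integrable by simp
  then show ?thesis by (simp add: exp_add[symmetric] algebra_simps)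
qed

lemma moment_integrable_strong:
  assumes "\<kappa> - r \<in> S" "\<kappa> + r \<in> S" "r > 0"
  shows "integrable N (\<lambda>t. \<bar>t - y\<bar> ^ k * exp (\<kappa> * (t - y)))"
proof (rule Bochner_Integration.integrable_bound)
  let ?C = "fact k / r ^ k"
  show "integrable N (\<lambda>t. ?C * (exp ((\<kappa> + r) * (t - y)) + exp ((\<kappa> - r) * (t - y))))"
    using assms by (intro integrable_mult_right Bochner_Integration.integrable_add shifted_exp_integrable)
  show "(\<lambda>t. \<bar>t - y\<bar> ^ k * exp (\<kappa> * (t - y))) \<in> borel_measurable N"
    by (intro measurable_N) measurable
  show "AE t in N. norm (\<bar>t - y\<bar> ^ k * exp (\<kappa> * (t - y)))
      \<le> norm (?C * (exp ((\<kappa> + r) * (t - y)) + exp ((\<kappa> - r) * (t - y))))"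
  proof (intro AE_I2)
    fix t
    have "\<bar>t - y\<bar> ^ k * exp (\<kappa> * (t - y))
        \<le> ?C * (exp (r * (t - y)) + exp (- (r * (t - y)))) * exp (\<kappa> * (t - y))"
      by (intro mult_right_mono power_le_exp_abs assms) auto
    also have "\<dots> = ?C * (exp ((\<kappa> + r) * (t - y)) + exp ((\<kappa> - r) * (t - y)))"
      by (simp add: algebra_simps flip: exp_add)
    finally show "norm (\<bar>t - y\<bar> ^ k * exp (\<kappa> * (t - y)))
      \<le> norm (?C * (exp ((\<kappa> + r) * (t - y)) + exp ((\<kappa> - r) * (t - y))))"
      using assms(3) by (simp add: abs_mult power_abs)
  qed
qed

lemma abs_moment_integrable:
  assumes "\<kappa> \<in> S" shows "integrable N (\<lambda>t. \<bar>t - y\<bar> ^ k * exp (\<kappa> * (t - y)))"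
proof -
  obtain \<kappa>' where "\<kappa> < \<kappa>'" "\<kappa>' \<in> S" using S_right[OF assms] by blast
  then show ?thesis using S_down[OF assms, of "\<kappa> - (\<kappa>' - \<kappa>)"]
    by (intro moment_integrable_strong[of \<kappa> "\<kappa>' - \<kappa>"]) auto
qed

lemma moment_integrable:
  assumes "\<kappa> \<in> S" shows "integrable N (\<lambda>t. (t - y) ^ k * exp (\<kappa> * (t - y)))"
proof (rule Bochner_Integration.integrable_bound[OF abs_moment_integrable[OF assms, of y k]])
  show "(\<lambda>t. (t - y) ^ k * exp (\<kappa> * (t - y))) \<in> borel_measurable N"
    by (intro measurable_N) measurable
qed (auto simp: abs_mult power_abs)

text \<open>
  Differentiation under the integral: the remainder of the difference quotient is at most \<open>\<bar>h\<bar>\<close>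
  times \<open>\<bar>Z\<bar>^(k+2) exp(\<kappa> Z + r \<bar>Z\<bar>)\<close>, whose integral does not depend on \<open>h\<close>.
\<close>
lemma moment_deriv:
  assumes "\<kappa> \<in> S"
  shows "(moment y k has_real_derivative moment y (Suc k) \<kappa>) (at \<kappa>)"
proof -
  obtain \<kappa>' where \<kappa>': "\<kappa> < \<kappa>'" "\<kappa>' \<in> S" using S_right[OF assms] by blast
  define r where "r = (\<kappa>' - \<kappa>) / 2"
  have r: "r > 0" "\<kappa> + r \<in> S" "\<kappa> - r \<in> S"
    using \<kappa>' S_down[OF \<kappa>'(2)] by (auto simp: r_def field_simps)
  define H where "H t = \<bar>t - y\<bar> ^ (k + 2) * exp ((\<kappa> + r) * (t - y)) + \<bar>t - y\<bar> ^ (k + 2) * exp ((\<kappa> - r) * (t - y))" for t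
  have H: "integrable N H" unfolding H_def[abs_def]
    using r by (intro Bochner_Integration.integrable_add abs_moment_integrable)
  have bound: "\<bar>(moment y k (\<kappa> + h) - moment y k \<kappa>) / h - moment y (Suc k) \<kappa>\<bar> \<le> \<bar>h\<bar> * (\<integral>t. H t \<partial>N)"
    if h: "h \<noteq> 0" "\<bar>h\<bar> < r" for h
  proof -
    have hS: "\<kappa> + h \<in> S" using S_down[OF r(2)] h by simp
    define R where "R t = (t - y) ^ k * exp (\<kappa> * (t - y)) * (exp (h * (t - y)) - 1 - h * (t - y)) / h" for t
    have R_eq: "R t = ((t - y) ^ k * exp ((\<kappa> + h) * (t - y)) - (t - y) ^ k * exp (\<kappa> * (t - y))) / h
        - (t - y) ^ Suc k * exp (\<kappa> * (t - y))" for t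
    proof -
      have "exp ((\<kappa> + h) * (t - y)) = exp (\<kappa> * (t - y)) * exp (h * (t - y))"
        by (simp add: distrib_right exp_add)
      moreover have "p * a * (b - 1 - h * u) / h = (p * (a * b) - p * a) / h - u * p * a" for p a b u :: real
        using h by (simp add: field_simps)
      ultimately show ?thesis by (simp add: R_def)
    qed
    have int_R: "integrable N R" unfolding R_eq[abs_def]
      using hS assms by (intro Bochner_Integration.integrable_diff integrable_divide moment_integrable)
    have "(moment y k (\<kappa> + h) - moment y k \<kappa>) / h - moment y (Suc k) \<kappa> = (\<integral>t. R t \<partial>N)"
      unfolding R_eq[abs_def] moment_def
      using moment_integrable[OF hS] moment_integrable[OF assms]
      by (subst Bochner_Integration.integral_diff, simp_all del: power_Suc)
    also have "\<bar>\<dots>\<bar> \<le> (\<integral>t. \<bar>R t\<bar> \<partial>N)" using integral_abs_bound by blast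
    also have "\<dots> \<le> (\<integral>t. \<bar>h\<bar> * H t \<partial>N)"
    proof (rule integral_mono)
      show "integrable N (\<lambda>t. \<bar>R t\<bar>)" using int_R by simp
      show "integrable N (\<lambda>t. \<bar>h\<bar> * H t)" using H by simp
      fix t
      define u where "u = t - y"
      have "\<bar>R t\<bar> = \<bar>u\<bar> ^ k * exp (\<kappa> * u) * \<bar>exp (h * u) - 1 - h * u\<bar> / \<bar>h\<bar>"
        by (simp add: R_def u_def abs_mult power_abs)
      also have "\<dots> \<le> \<bar>u\<bar> ^ k * exp (\<kappa> * u) * ((h * u)^2 * exp \<bar>h * u\<bar>) / \<bar>h\<bar>"
        by (intro divide_right_mono mult_left_mono exp_remainder_bound) auto
      also have "(h * u)^2 = \<bar>h\<bar> * \<bar>h\<bar> * \<bar>u\<bar>^2" by (simp add: power2_eq_square flip: abs_mult)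
      also have "\<bar>u\<bar> ^ k * exp (\<kappa> * u) * (\<bar>h\<bar> * \<bar>h\<bar> * \<bar>u\<bar>^2 * exp \<bar>h * u\<bar>) / \<bar>h\<bar>
          = \<bar>h\<bar> * (\<bar>u\<bar> ^ (k + 2) * (exp (\<kappa> * u) * exp \<bar>h * u\<bar>))"
      proof -
        have cancel: "a ^ k * e * (q * q * a^2 * w) / q = q * (a ^ (k + 2) * (e * w))"
          if "q \<noteq> 0" for a e q w :: real
          using that by (simp add: power_add power2_eq_square field_simps)
        show ?thesis by (rule cancel) (use h in simp)
      qed
      also have "\<dots> \<le> \<bar>h\<bar> * (\<bar>u\<bar> ^ (k + 2) * (exp ((\<kappa> + r) * u) + exp ((\<kappa> - r) * u)))"
      proof (intro mult_left_mono)
        have "\<bar>h * u\<bar> \<le> r * \<bar>u\<bar>" using h by (simp add: abs_mult mult_right_mono)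
        then have "exp (\<kappa> * u) * exp \<bar>h * u\<bar> \<le> exp (\<kappa> * u + r * \<bar>u\<bar>)" by (simp flip: exp_add)
        also have "\<dots> \<le> exp ((\<kappa> + r) * u) + exp ((\<kappa> - r) * u)"
          by (cases "u \<ge> 0") (simp_all add: algebra_simps)
        finally show "exp (\<kappa> * u) * exp \<bar>h * u\<bar> \<le> exp ((\<kappa> + r) * u) + exp ((\<kappa> - r) * u)" .
      qed auto
      finally show "\<bar>R t\<bar> \<le> \<bar>h\<bar> * H t" by (simp add: H_def u_def algebra_simps)
    qed
    finally show ?thesis by simp
  qed
  have "((\<lambda>h. (moment y k (\<kappa> + h) - moment y k \<kappa>) / h - moment y (Suc k) \<kappa>) \<longlongrightarrow> 0) (at 0)"
  proof (rule tendsto_0_le)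
    show "((\<lambda>h::real. h) \<longlongrightarrow> 0) (at 0)" by (rule tendsto_ident_at)
    have "\<forall>\<^sub>F h in at 0. h \<noteq> 0 \<and> \<bar>h\<bar> < r"
      unfolding eventually_at using r by (intro exI[of _ r]) auto
    then show "\<forall>\<^sub>F h in at 0. norm ((moment y k (\<kappa> + h) - moment y k \<kappa>) / h - moment y (Suc k) \<kappa>)
        \<le> norm h * (\<integral>t. H t \<partial>N)"
      by eventually_elim (use bound in auto)
  qed
  then show ?thesis unfolding DERIV_def by (simp add: LIM_zero_iff)
qed

lemma moment0_pos: assumes "\<kappa> \<in> S" shows "moment y 0 \<kappa> > 0"
proof -
  have "(\<integral>t. exp (\<kappa> * (t - y)) \<partial>N) \<noteq> 0"
  proof
    assume "(\<integral>t. exp (\<kappa> * (t - y)) \<partial>N) = 0"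
    then have "AE t in N. exp (\<kappa> * (t - y)) = 0"
      using integral_nonneg_eq_0_iff_AE[OF shifted_exp_integrable[OF assms]] by simp
    then show False by simp
  qed
  moreover have "(\<integral>t. exp (\<kappa> * (t - y)) \<partial>N) \<ge> 0" by (intro integral_nonneg_AE) auto
  ultimately show ?thesis by (simp add: moment_def less_le)
qed

text \<open>
  The left-hand side is the integral of \<open>(Z^j (Z - a))\<^sup>2 exp(\<kappa> Z)\<close>.  Choosing \<open>a\<close> as a quotient of
  moments gives the strict Hankel inequalities.
\<close>
lemma quadratic_form_pos:
  assumes "\<kappa> \<in> S" and nz: "\<not> (AE t in N. (t - y) ^ j * (t - y - a) = 0)"
  shows "moment y (2*j+2) \<kappa> - 2 * a * moment y (2*j+1) \<kappa> + a^2 * moment y (2*j) \<kappa> > 0"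
proof -
  let ?f = "\<lambda>t. ((t - y) ^ j * (t - y - a))^2 * exp (\<kappa> * (t - y))"
  have f_eq: "?f = (\<lambda>t. (t - y) ^ (2*j+2) * exp (\<kappa> * (t - y)) - 2 * a * ((t - y) ^ (2*j+1) * exp (\<kappa> * (t - y)))
      + a^2 * ((t - y) ^ (2*j) * exp (\<kappa> * (t - y))))"
  proof
    fix t
    define u p where "u = t - y" and "p = u ^ j"
    have "u ^ (2*j) = p * p" "u ^ (2*j+1) = p * p * u" "u ^ (2*j+2) = p * p * u * u"
      by (simp_all add: p_def mult_2 power_add power2_eq_square)
    then show "?f t = (t - y) ^ (2*j+2) * exp (\<kappa> * (t - y)) - 2 * a * ((t - y) ^ (2*j+1) * exp (\<kappa> * (t - y)))
      + a^2 * ((t - y) ^ (2*j) * exp (\<kappa> * (t - y)))"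
      unfolding u_def[symmetric] p_def[symmetric] by (simp add: power2_eq_square algebra_simps)
  qed
  have int: "integrable N ?f" unfolding f_eq
    by (intro Bochner_Integration.integrable_add Bochner_Integration.integrable_diff
        integrable_mult_right moment_integrable assms)
  have "(\<integral>t. ?f t \<partial>N) = moment y (2*j+2) \<kappa> - 2 * a * moment y (2*j+1) \<kappa> + a^2 * moment y (2*j) \<kappa>"
    unfolding f_eq moment_def
    by (simp add: moment_integrable[OF assms(1)] Bochner_Integration.integral_add Bochner_Integration.integral_diff del: power_Suc power_add)
  moreover have "(\<integral>t. ?f t \<partial>N) \<ge> 0" by (intro integral_nonneg_AE) auto
  moreover have "(\<integral>t. ?f t \<partial>N) \<noteq> 0"
    using integral_nonneg_eq_0_iff_AE[OF int] nz by auto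
  ultimately show ?thesis by simp
qed

lemma mgf_moment: "\<kappa> \<in> S \<Longrightarrow> mgf N \<kappa> = exp (\<kappa> * y) * moment y 0 \<kappa>"
  unfolding mgf_def moment_def by (simp add: algebra_simps flip: exp_add Bochner_Integration.integral_mult_right_zero)

lemma S_dom: "\<kappa> \<in> S \<Longrightarrow> \<kappa> \<in> mgf_dom N"
  using exp_integrable by (simp add: mgf_dom_def)

text \<open>
  A critical point is a global maximizer over the whole domain, also where the generating function is
  not differentiable: integrate \<open>1 + u \<le> exp u\<close> with \<open>u = (\<kappa> - \<kappa>0)(X - t)\<close> against the weight
  \<open>exp(\<kappa>0 (X - t))\<close>; the linear term vanishes by criticality.
\<close>
lemma critical_point_minimal:
  assumes "\<kappa>0 \<in> S" "moment t 1 \<kappa>0 = 0" "\<kappa> \<in> mgf_dom N"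
  shows "\<kappa> * t - ln (mgf N \<kappa>) \<le> \<kappa>0 * t - ln (mgf N \<kappa>0)"
proof -
  have int: "integrable N (\<lambda>x. exp (\<kappa> * (x - t)))"
  proof -
    have "integrable N (\<lambda>x. exp (- \<kappa> * t) * exp (\<kappa> * x))" using assms by (simp add: mgf_dom_def)
    then show ?thesis by (simp add: exp_add[symmetric] algebra_simps)
  qed
  have mgf: "mgf N \<kappa> = exp (\<kappa> * t) * (\<integral>x. exp (\<kappa> * (x - t)) \<partial>N)"
    unfolding mgf_def by (simp add: algebra_simps flip: exp_add Bochner_Integration.integral_mult_right_zero)
  have "moment t 0 \<kappa>0 = moment t 0 \<kappa>0 + (\<kappa> - \<kappa>0) * moment t 1 \<kappa>0" using assms by simp
  also have "\<dots> = (\<integral>x. (x - t)^0 * exp (\<kappa>0 * (x - t)) + (\<kappa> - \<kappa>0) * ((x - t)^1 * exp (\<kappa>0 * (x - t))) \<partial>N)"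
    unfolding moment_def
    by (subst Bochner_Integration.integral_add, rule moment_integrable[OF assms(1)],
        rule integrable_mult_right, rule moment_integrable[OF assms(1)],
        subst integral_mult_right_zero, rule refl)
  also have "\<dots> \<le> (\<integral>x. exp (\<kappa> * (x - t)) \<partial>N)"
  proof (rule integral_mono[OF _ int])
    show "integrable N (\<lambda>x. (x - t)^0 * exp (\<kappa>0 * (x - t)) + (\<kappa> - \<kappa>0) * ((x - t)^1 * exp (\<kappa>0 * (x - t))))"
      by (intro Bochner_Integration.integrable_add integrable_mult_right moment_integrable assms)
    fix x
    have "(1 + (\<kappa> - \<kappa>0) * (x - t)) * exp (\<kappa>0 * (x - t)) \<le> exp ((\<kappa> - \<kappa>0) * (x - t)) * exp (\<kappa>0 * (x - t))"
      by (intro mult_right_mono exp_ge_add_one_self) auto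
    also have "\<dots> = exp (\<kappa> * (x - t))" by (simp add: algebra_simps flip: exp_add)
    finally show "(x - t)^0 * exp (\<kappa>0 * (x - t)) + (\<kappa> - \<kappa>0) * ((x - t)^1 * exp (\<kappa>0 * (x - t))) \<le> exp (\<kappa> * (x - t))"
      by (simp add: algebra_simps)
  qed
  finally have le: "moment t 0 \<kappa>0 \<le> (\<integral>x. exp (\<kappa> * (x - t)) \<partial>N)" .
  have pos: "moment t 0 \<kappa>0 > 0" using moment0_pos assms by simp
  then have "ln (moment t 0 \<kappa>0) \<le> ln (\<integral>x. exp (\<kappa> * (x - t)) \<partial>N)" using le by simp
  then show ?thesis using pos le by (simp add: mgf mgf_moment[OF assms(1), of t] ln_mult)
qed

lemma rate_critical:
  assumes "\<kappa>0 \<in> S" "moment t 1 \<kappa>0 = 0"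
  shows "rate N t = \<kappa>0 * t - ln (mgf N \<kappa>0)"
  unfolding rate_def
  by (rule cSup_eq_maximum) (use assms critical_point_minimal S_dom in auto)

lemma mgf_pos: "\<kappa> \<in> S \<Longrightarrow> mgf N \<kappa> > 0"
  using mgf_moment[of \<kappa> 0] moment0_pos[of \<kappa> 0] by simp

lemma tilted_mgf:
  assumes "\<kappa>1 \<in> S"
  shows "mgf (tilted N \<kappa>1) \<theta> = mgf N (\<kappa>1 + \<theta>) / mgf N \<kappa>1"
    and "\<theta> \<in> mgf_dom (tilted N \<kappa>1) \<longleftrightarrow> \<kappa>1 + \<theta> \<in> mgf_dom N"
proof -
  have [measurable]: "(\<lambda>t. exp (\<kappa>1 * t) / mgf N \<kappa>1) \<in> borel_measurable N" "(\<lambda>t. exp (\<theta> * t)) \<in> borel_measurable N"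
    by (intro measurable_N; measurable)+
  have nn: "AE t in N. 0 \<le> exp (\<kappa>1 * t) / mgf N \<kappa>1" using mgf_pos[OF assms] by simp
  have eq: "(\<lambda>t. (exp (\<kappa>1 * t) / mgf N \<kappa>1) *\<^sub>R exp (\<theta> * t)) = (\<lambda>t. exp ((\<kappa>1 + \<theta>) * t) / mgf N \<kappa>1)"
    by (simp add: exp_add algebra_simps)
  show "mgf (tilted N \<kappa>1) \<theta> = mgf N (\<kappa>1 + \<theta>) / mgf N \<kappa>1"
  proof -
    have "mgf (tilted N \<kappa>1) \<theta> = (\<integral>t. exp (\<theta> * t) \<partial>density N (\<lambda>t. ennreal (exp (\<kappa>1 * t) / mgf N \<kappa>1)))"
      by (subst mgf_def) (simp only: tilted_def)
    also have "\<dots> = (\<integral>t. exp ((\<kappa>1 + \<theta>) * t) / mgf N \<kappa>1 \<partial>N)"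
      by (subst integral_density[OF _ _ nn]) (simp_all only: eq, simp_all)
    also have "\<dots> = mgf N (\<kappa>1 + \<theta>) / mgf N \<kappa>1" by (subst mgf_def) simp
    finally show ?thesis .
  qed
  show "\<theta> \<in> mgf_dom (tilted N \<kappa>1) \<longleftrightarrow> \<kappa>1 + \<theta> \<in> mgf_dom N"
  proof -
    have "\<theta> \<in> mgf_dom (tilted N \<kappa>1) \<longleftrightarrow> integrable N (\<lambda>t. exp ((\<kappa>1 + \<theta>) * t) / mgf N \<kappa>1)"
      unfolding mgf_dom_def tilted_def mem_Collect_eq
      by (subst integrable_density[OF _ _ nn]) (simp_all only: eq, simp_all)
    also have "\<dots> \<longleftrightarrow> \<kappa>1 + \<theta> \<in> mgf_dom N"
      using mgf_pos[OF assms] by (simp add: mgf_dom_def divide_inverse del: inverse_eq_divide)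
    finally show ?thesis .
  qed
qed

text \<open>
  Tilting shifts the parameter and normalizes the generating function, so the supremum for
  the tilted law is attained at the shift of the maximizer for \<open>N\<close>.
\<close>
lemma tilted_rate_critical:
  assumes "\<kappa>0 \<in> S" "moment t 1 \<kappa>0 = 0" "\<kappa>1 \<in> S"
  shows "rate (tilted N \<kappa>1) t = (\<kappa>0 - \<kappa>1) * (t - y) - ln (moment y 0 \<kappa>0) + ln (moment y 0 \<kappa>1)"
proof -
  have pos: "moment y 0 \<kappa>0 > 0" "moment y 0 \<kappa>1 > 0" "mgf N \<kappa>1 > 0" "mgf N \<kappa>0 > 0"
    using assms moment0_pos mgf_pos by auto
  have "rate (tilted N \<kappa>1) t = (\<kappa>0 - \<kappa>1) * t - ln (mgf N \<kappa>0 / mgf N \<kappa>1)"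
    unfolding rate_def
  proof (rule cSup_eq_maximum)
    show "(\<kappa>0 - \<kappa>1) * t - ln (mgf N \<kappa>0 / mgf N \<kappa>1) \<in>
        (\<lambda>\<xi>. \<xi> * t - ln (mgf (tilted N \<kappa>1) \<xi>)) ` mgf_dom (tilted N \<kappa>1)"
      using assms S_dom by (intro image_eqI[of _ _ "\<kappa>0 - \<kappa>1"]) (simp_all add: tilted_mgf)
    fix s assume "s \<in> (\<lambda>\<xi>. \<xi> * t - ln (mgf (tilted N \<kappa>1) \<xi>)) ` mgf_dom (tilted N \<kappa>1)"
    then obtain \<theta> where \<theta>: "\<kappa>1 + \<theta> \<in> mgf_dom N" "s = \<theta> * t - ln (mgf N (\<kappa>1 + \<theta>) / mgf N \<kappa>1)"
      using assms by (auto simp: tilted_mgf)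
    have "mgf N (\<kappa>1 + \<theta>) > 0"
    proof -
      have int: "integrable N (\<lambda>t. exp ((\<kappa>1 + \<theta>) * t))" using \<theta> by (simp add: mgf_dom_def)
      have "mgf N (\<kappa>1 + \<theta>) \<noteq> 0"
        unfolding mgf_def using integral_nonneg_eq_0_iff_AE[OF int] by auto
      moreover have "mgf N (\<kappa>1 + \<theta>) \<ge> 0" unfolding mgf_def by (intro integral_nonneg_AE) auto
      ultimately show ?thesis by simp
    qed
    then show "s \<le> (\<kappa>0 - \<kappa>1) * t - ln (mgf N \<kappa>0 / mgf N \<kappa>1)"
      using critical_point_minimal[OF assms(1,2) \<theta>(1)] pos by (simp add: \<theta>(2) ln_div algebra_simps)
  qed
  also have "\<dots> = (\<kappa>0 - \<kappa>1) * (t - y) - ln (moment y 0 \<kappa>0) + ln (moment y 0 \<kappa>1)"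
    using pos assms by (simp add: mgf_moment[of _ y] ln_div ln_mult algebra_simps)
  finally show ?thesis .
qed

lemma moment_shift1: "\<kappa> \<in> S \<Longrightarrow> moment (y + s) 1 \<kappa> = exp (- \<kappa> * s) * (moment y 1 \<kappa> - s * moment y 0 \<kappa>)"
proof -
  assume k: "\<kappa> \<in> S"
  have "moment (y + s) 1 \<kappa> = (\<integral>t. exp (- \<kappa> * s) * ((t - y)^1 * exp (\<kappa> * (t - y)) - s * ((t - y)^0 * exp (\<kappa> * (t - y)))) \<partial>N)"
    unfolding moment_def by (intro Bochner_Integration.integral_cong refl) (simp add: algebra_simps flip: exp_add)
  also have "\<dots> = exp (- \<kappa> * s) * (moment y 1 \<kappa> - s * moment y 0 \<kappa>)"
    unfolding moment_def using moment_integrable[OF k, of y 0] moment_integrable[OF k, of y 1]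
    by simp
  finally show ?thesis .
qed

lemma deriv_objective:
  assumes "\<kappa> \<in> S"
  shows "((\<lambda>\<xi>. \<xi> * t - ln (mgf N \<xi>)) has_real_derivative - (moment t 1 \<kappa> / moment t 0 \<kappa>)) (at \<kappa>)"
proof -
  obtain \<kappa>' where \<kappa>': "\<kappa> < \<kappa>'" "\<kappa>' \<in> S" using S_right[OF assms] by blast
  have d: "((\<lambda>\<xi>. - ln (moment t 0 \<xi>)) has_real_derivative - (moment t 1 \<kappa> / moment t 0 \<kappa>)) (at \<kappa>)"
    using moment0_pos[OF assms, of t] moment_deriv[OF assms, of t 0]
    by (auto intro!: derivative_eq_intros)
  have "\<forall>\<^sub>F \<xi> in nhds \<kappa>. \<xi> * t - ln (mgf N \<xi>) = - ln (moment t 0 \<xi>)"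
  proof -
    have "\<forall>\<^sub>F \<xi> in nhds \<kappa>. \<xi> \<in> {..<\<kappa>'}" using \<kappa>' by (intro eventually_nhds_in_open) auto
    then show ?thesis
    proof eventually_elim
      case (elim \<xi>)
      then have "\<xi> \<in> S" using S_down[OF \<kappa>'(2)] by auto
      then show ?case using moment0_pos[of \<xi> t] by (simp add: mgf_moment[of \<xi> t] ln_mult)
    qed
  qed
  then show ?thesis using d by (subst DERIV_cong_ev[OF refl _ refl]) auto
qed

text \<open>
  A maximizer over the half line \<open>\<xi> \<ge> 0\<close> that is interior is a critical point; at the boundary
  point \<open>0\<close> criticality has to be supplied.
\<close>
lemma dual_critical:
  assumes "is_arg_max (\<lambda>\<xi>. \<xi> * t - ln (mgf N \<xi>)) (\<lambda>\<xi>. \<xi> \<in> mgf_dom N \<and> \<xi> \<ge> 0) \<kappa>"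
    and "\<kappa> \<in> S" and "\<kappa> = 0 \<Longrightarrow> moment t 1 0 = 0"
  shows "moment t 1 \<kappa> = 0"
proof (cases "\<kappa> = 0")
  case False
  define f where "f \<xi> = \<xi> * t - ln (mgf N \<xi>)" for \<xi>
  have \<kappa>: "\<kappa> > 0" and max: "\<And>\<xi>. \<xi> \<in> mgf_dom N \<Longrightarrow> \<xi> \<ge> 0 \<Longrightarrow> f \<xi> \<le> f \<kappa>"
    using assms(1) False by (auto simp: is_arg_max_def f_def not_less)
  obtain \<kappa>' where \<kappa>': "\<kappa> < \<kappa>'" "\<kappa>' \<in> S" using S_right[OF assms(2)] by blast
  have "- (moment t 1 \<kappa> / moment t 0 \<kappa>) = 0"
  proof (rule DERIV_local_max[of f])
    show "(f has_real_derivative - (moment t 1 \<kappa> / moment t 0 \<kappa>)) (at \<kappa>)"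
      unfolding f_def[abs_def] by (rule deriv_objective[OF assms(2)])
    show "0 < min \<kappa> (\<kappa>' - \<kappa>)" using \<kappa> \<kappa>' by simp
    show "\<forall>\<xi>. \<bar>\<kappa> - \<xi>\<bar> < min \<kappa> (\<kappa>' - \<kappa>) \<longrightarrow> f \<xi> \<le> f \<kappa>"
    proof (intro allI impI)
      fix \<xi> assume "\<bar>\<kappa> - \<xi>\<bar> < min \<kappa> (\<kappa>' - \<kappa>)"
      then show "f \<xi> \<le> f \<kappa>" using S_down[OF \<kappa>'(2), of \<xi>] S_dom by (intro max) auto
    qed
  qed
  then show ?thesis using moment0_pos[OF assms(2), of t] by simp
qed (use assms in simp)

lemma dual_zero:
  assumes "is_arg_max (\<lambda>\<xi>. \<xi> * t - ln (mgf N \<xi>)) (\<lambda>\<xi>. \<xi> \<in> mgf_dom N \<and> \<xi> \<ge> 0) 0" and "0 \<in> S"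
  shows "moment t 1 0 \<ge> 0"
proof (rule ccontr)
  assume neg: "\<not> moment t 1 0 \<ge> 0"
  define f where "f \<xi> = \<xi> * t - ln (mgf N \<xi>)" for \<xi>
  have "(f has_real_derivative - (moment t 1 0 / moment t 0 0)) (at 0)"
    unfolding f_def[abs_def] by (rule deriv_objective[OF assms(2)])
  moreover have "- (moment t 1 0 / moment t 0 0) > 0"
    using neg moment0_pos[OF assms(2), of t] by (simp add: divide_less_0_iff)
  ultimately obtain d where d: "d > 0" "\<And>h. h > 0 \<Longrightarrow> h < d \<Longrightarrow> f 0 < f (0 + h)"
    using DERIV_pos_inc_right by blast
  obtain \<kappa>' where \<kappa>': "0 < \<kappa>'" "\<kappa>' \<in> S" using S_right[OF assms(2)] by blast
  define h where "h = min (d/2) \<kappa>'"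
  have h: "0 < h" "h < d" "h \<in> S" using d \<kappa>' S_down[OF \<kappa>'(2), of h] by (auto simp: h_def)
  then have "f 0 < f h" using d by simp
  then show False using assms(1) S_dom[OF h(3)] h(1) by (auto simp: is_arg_max_def f_def)
qed

lemma integrable_id: assumes "0 \<in> S" shows "integrable N (\<lambda>x. x)"
  using moment_integrable[OF assms, of 0 1] by simp

lemma moment1_zero: assumes "0 \<in> S" shows "moment t 1 0 = (\<integral>x. x \<partial>N) - t"
  unfolding moment_def using integrable_id[OF assms] prob_space by simp

text \<open>Consequences of the attained suprema for the dual function at and above the mean \<open>m\<close>.\<close>

context
  fixes m y :: real
  assumes zero_S: "0 \<in> S" and m_def: "m = (\<integral>x. x \<partial>N)"
    and dual_max: "\<And>t. t \<ge> m \<Longrightarrow> is_arg_max (\<lambda>\<xi>. \<xi> * t - ln (mgf N \<xi>)) (\<lambda>\<xi>. \<xi> \<in> mgf_dom N \<and> \<xi> \<ge> 0) (legendre_dual N t)"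
    and dual_S: "\<And>t. t \<ge> m \<Longrightarrow> legendre_dual N t \<in> S"
begin

lemma dual_is_critical: assumes "t \<ge> m" shows "moment t 1 (legendre_dual N t) = 0"
proof (rule dual_critical[OF dual_max[OF assms] dual_S[OF assms]])
  assume "legendre_dual N t = 0"
  then have "moment t 1 0 \<ge> 0" using dual_zero[of t] dual_max[OF assms] zero_S by simp
  then show "moment t 1 0 = 0" using assms by (simp only: moment1_zero[OF zero_S] m_def)
qed

text \<open>A constant has the same mean after every tilt, so it cannot be critical for two values \<open>t\<close>.\<close>
lemma not_constant: "\<not> (AE x in N. x = a)"
proof
  assume ae: "AE x in N. x = a"
  have "t = a" if "t \<ge> m" for t
  proof -
    let ?k = "legendre_dual N t"
    have "moment t 1 ?k = (\<integral>x. (a - t)^1 * exp (?k * (a - t)) \<partial>N)"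
      unfolding moment_def
    proof (rule integral_cong_AE)
      show "AE x in N. (x - t)^1 * exp (?k * (x - t)) = (a - t)^1 * exp (?k * (a - t))"
        using ae by eventually_elim simp
    qed (intro measurable_N; measurable)+
    also have "\<dots> = (a - t) * exp (?k * (a - t))" using prob_space by simp
    finally show ?thesis using dual_is_critical[OF that] by simp
  qed
  from this[of m] this[of "m + 1"] show False by simp
qed

lemma dual_pos: assumes "m < t" shows "legendre_dual N t > 0"
proof -
  have "legendre_dual N t \<ge> 0" using dual_max[of t] assms by (auto simp: is_arg_max_def)
  moreover have "legendre_dual N t \<noteq> 0"
  proof
    assume "legendre_dual N t = 0"
    then have "moment t 1 0 = 0" using dual_is_critical[of t] assms by simp
    then show False using assms by (simp only: moment1_zero[OF zero_S] m_def)
  qed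
  ultimately show ?thesis by simp
qed

text \<open>
  If \<open>X - t\<close> took only the values \<open>0\<close> and \<open>a\<close>, it would have a fixed sign; being centred after the
  tilt by the dual point of \<open>t\<close>, it would vanish.
\<close>
lemma not_two_point_at_shift:
  assumes "m < t" shows "\<not> (AE x in N. (x - t) ^ 1 * (x - t - a) = 0)"
proof
  assume ae: "AE x in N. (x - t) ^ 1 * (x - t - a) = 0"
  let ?k = "legendre_dual N t"
  have kS: "?k \<in> S" and crit: "(\<integral>x. (x - t)^1 * exp (?k * (x - t)) \<partial>N) = 0"
    using dual_S[of t] dual_is_critical[of t] assms by (auto simp: moment_def)
  define s where "s = (if a \<ge> 0 then 1 else - 1 :: real)"
  have "integrable N (\<lambda>x. s * ((x - t)^1 * exp (?k * (x - t))))"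
    by (intro integrable_mult_right moment_integrable kS)
  moreover have "AE x in N. 0 \<le> s * ((x - t)^1 * exp (?k * (x - t)))"
    using ae by eventually_elim (auto simp: s_def mult_le_0_iff)
  moreover have "(\<integral>x. s * ((x - t)^1 * exp (?k * (x - t))) \<partial>N) = 0" using crit by simp
  ultimately have "AE x in N. s * ((x - t)^1 * exp (?k * (x - t))) = 0"
    using integral_nonneg_eq_0_iff_AE by blast
  then have "AE x in N. x = t" by eventually_elim (auto simp: s_def split: if_splits)
  then show False using not_constant by blast
qed

lemma exponential_moments_at:
  assumes y: "m < y" and mono: "mono_on {m..} (legendre_dual N)" and conc: "concave_on {m..} (legendre_dual N)"
  shows "exponential_moments S (legendre_dual N y) (moment y 0) (moment y 1) (moment y 2) (moment y 3) (moment y 4)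
     (\<lambda>t. legendre_dual N (y + t))"
proof
  fix \<kappa> assume \<kappa>: "\<kappa> \<in> S"
  show "\<And>\<kappa>'. \<kappa>' \<le> \<kappa> \<Longrightarrow> \<kappa>' \<in> S" using S_down \<kappa> by blast
  show "(moment y 0 has_real_derivative moment y 1 \<kappa>) (at \<kappa>)"
    "(moment y 1 has_real_derivative moment y 2 \<kappa>) (at \<kappa>)"
    "(moment y 2 has_real_derivative moment y 3 \<kappa>) (at \<kappa>)"
    "(moment y 3 has_real_derivative moment y 4 \<kappa>) (at \<kappa>)"
    using moment_deriv[OF \<kappa>, of y 0] moment_deriv[OF \<kappa>, of y 1] moment_deriv[OF \<kappa>, of y 2] moment_deriv[OF \<kappa>, of y 3]
    by (simp_all add: eval_nat_numeral)
  show m0: "0 < moment y 0 \<kappa>" using moment0_pos \<kappa> .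
  have nc: "\<not> (AE x in N. (x - y) ^ 0 * (x - y - b) = 0)" for b
  proof
    assume "AE x in N. (x - y) ^ 0 * (x - y - b) = 0"
    then have "AE x in N. x = y + b" by eventually_elim simp
    then show False using not_constant by blast
  qed
  show m2: "0 < moment y 2 \<kappa>" using quadratic_form_pos[OF \<kappa> nc[of 0]] by (simp add: numeral_2_eq_2)
  define b where "b = moment y 1 \<kappa> / moment y 0 \<kappa>"
  have b: "moment y 1 \<kappa> = b * moment y 0 \<kappa>" using m0 by (simp add: b_def)
  have "moment y 2 \<kappa> - 2 * b * moment y 1 \<kappa> + b^2 * moment y 0 \<kappa> > 0"
    using quadratic_form_pos[OF \<kappa> nc[of b]] by (simp add: numeral_2_eq_2)
  then have "moment y 0 \<kappa> * (moment y 2 \<kappa> - b^2 * moment y 0 \<kappa>) > 0"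
    using m0 unfolding b by (intro mult_pos_pos) (auto simp: power2_eq_square algebra_simps)
  then show "(moment y 1 \<kappa>)\<^sup>2 < moment y 0 \<kappa> * moment y 2 \<kappa>"
    unfolding b by (simp add: power2_eq_square algebra_simps)
  define b' where "b' = moment y 3 \<kappa> / moment y 2 \<kappa>"
  have b': "moment y 3 \<kappa> = b' * moment y 2 \<kappa>" using m2 by (simp add: b'_def)
  have "moment y 4 \<kappa> - 2 * b' * moment y 3 \<kappa> + b'^2 * moment y 2 \<kappa> > 0"
    using quadratic_form_pos[OF \<kappa> not_two_point_at_shift[OF y, of b']] by (simp add: eval_nat_numeral)
  then have "moment y 2 \<kappa> * (moment y 4 \<kappa> - b'^2 * moment y 2 \<kappa>) > 0"
    using m2 unfolding b' by (intro mult_pos_pos) (auto simp: power2_eq_square algebra_simps)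
  then show "(moment y 3 \<kappa>)\<^sup>2 < moment y 2 \<kappa> * moment y 4 \<kappa>"
    unfolding b' by (simp add: power2_eq_square algebra_simps)
next
  show "0 < legendre_dual N y" using dual_pos y .
  show "legendre_dual N y \<in> S" using dual_S y by simp
  show "moment y 1 (legendre_dual N y) = 0" using dual_is_critical y by simp
next
  fix t :: real assume t: "0 \<le> t"
  then have my: "m \<le> y + t" using y by simp
  show "legendre_dual N (y + t) \<in> S" using dual_S[OF my] .
  show "legendre_dual N y \<le> legendre_dual N (y + t)" using mono my y t by (auto simp: mono_on_def)
  show "moment y 1 (legendre_dual N (y + t)) = t * moment y 0 (legendre_dual N (y + t))"
    using dual_is_critical[OF my] moment_shift1[OF dual_S[OF my], of y t] by simp
next
  show "concave_on {0..} (\<lambda>t. legendre_dual N (y + t))"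
    unfolding concave_on_iff
  proof (intro conjI ballI allI impI)
    fix s t u var :: real assume st: "s \<in> {0..}" "t \<in> {0..}" "0 \<le> u" "0 \<le> var" "u + var = 1"
    have eq: "y + (u *\<^sub>R s + var *\<^sub>R t) = u *\<^sub>R (y + s) + var *\<^sub>R (y + t)"
      using st(5) by (simp add: algebra_simps flip: distrib_right)
    show "u * legendre_dual N (y + s) + var * legendre_dual N (y + t) \<le> legendre_dual N (y + (u *\<^sub>R s + var *\<^sub>R t))"
      unfolding eq using conc st y unfolding concave_on_iff by auto
  qed simp
qed

end

section \<open>Transfer to the parameter \<alpha>\<close>

text \<open>
  \<open>kap\<close> and \<open>al\<close> are mutually inverse increasing changes of variable between \<open>\<alpha>\<close> and the tilting
  parameter.  Both definite descriptions are resolved through them: \<open>alpha_check\<close> is the image of the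
  turning point of \<open>D\<close>, and \<open>alpha_hat\<close> that of the zero of \<open>gap\<close>.
\<close>
lemma L_hat_unique_maximum:
  fixes m y :: real
  assumes zero_S: "0 \<in> S" and m_def: "m = (\<integral>x. x \<partial>N)" and m_nonneg: "m \<ge> 0"
    and dual_max: "\<And>t. t \<ge> m \<Longrightarrow> is_arg_max (\<lambda>\<xi>. \<xi> * t - ln (mgf N \<xi>)) (\<lambda>\<xi>. \<xi> \<in> mgf_dom N \<and> \<xi> \<ge> 0) (legendre_dual N t)"
    and dual_S: "\<And>t. t \<ge> m \<Longrightarrow> legendre_dual N t \<in> S"
    and mono: "mono_on {m..} (legendre_dual N)" and conc: "concave_on {m..} (legendre_dual N)"
    and y: "m < y"
  shows "\<exists>a\<in>{1<..<alpha_hat N y}. \<forall>\<alpha>>1. \<alpha> \<noteq> a \<longrightarrow> L_hat N \<alpha> y < L_hat N a y"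
proof -
  note One_nat_def[simp del]
  let ?X = "legendre_dual N"
  define c where "c = ?X y"
  interpret em: exponential_moments S c "moment y 0" "moment y 1" "moment y 2" "moment y 3" "moment y 4"
     "\<lambda>t. ?X (y + t)"
    unfolding c_def using exponential_moments_at[OF zero_S m_def dual_max dual_S y mono conc] .
  have y_pos: "y > 0" using y m_nonneg by simp
  have crit: "moment t 1 (?X t) = 0" if "t \<ge> m" for t
    using dual_is_critical[OF zero_S m_def dual_max dual_S that] .
  define kap where "kap \<alpha> = ?X (\<alpha> * y)" for \<alpha>
  define al where "al \<kappa> = 1 + em.mean \<kappa> / y" for \<kappa>
  have kap_eq: "kap \<alpha> = ?X (y + (\<alpha> - 1) * y)" for \<alpha> by (simp add: kap_def algebra_simps)
  have kap: "kap \<alpha> \<in> S" "c < kap \<alpha>" "em.mean (kap \<alpha>) = (\<alpha> - 1) * y" if "\<alpha> > 1" for \<alpha>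
    unfolding kap_eq using that y_pos by (auto intro!: em.Xi_S em.Xi_gt em.mean_Xi)
  have al_kap: "al (kap \<alpha>) = \<alpha>" if "\<alpha> > 1" for \<alpha> using kap(3)[OF that] y_pos by (simp add: al_def)
  have al_gt: "al \<kappa> > 1" if "\<kappa> \<in> S" "c < \<kappa>" for \<kappa> using em.mean_pos[OF that] y_pos by (simp add: al_def)
  have kap_al: "kap (al \<kappa>) = \<kappa>" if "\<kappa> \<in> S" "c < \<kappa>" for \<kappa>
    unfolding kap_eq using em.Xi_mean[of \<kappa>] that y_pos by (simp add: al_def)
  have kap_less: "kap \<alpha> < kap \<beta> \<longleftrightarrow> \<alpha> < \<beta>" if "\<alpha> > 1" "\<beta> > 1" for \<alpha> \<beta>
  proof -
    have "kap \<alpha> < kap \<beta>" if "\<alpha> > 1" "\<alpha> < \<beta>" for \<alpha> \<beta>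
      unfolding kap_eq using that y_pos by (intro em.Xi_strict) auto
    then show ?thesis using that by (metis less_asym linorder_neqE_linordered_idom)
  qed
  have tilted: "tilted_rate N \<alpha> y t = (?X t - kap \<alpha>) * (t - y) - ln (moment y 0 (?X t)) + ln (moment y 0 (kap \<alpha>))"
    if "\<alpha> > 1" "t \<ge> m" for \<alpha> t
    unfolding tilted_rate_def kap_def[symmetric]
    by (rule tilted_rate_critical[OF dual_S[OF that(2)] crit[OF that(2)] kap(1)[OF that(1)]])
  have m0: "moment y 0 \<kappa> > 0" if "\<kappa> \<in> S" for \<kappa> using moment0_pos[OF that] .
  have A: "A_fun N \<alpha> y = moment y 0 c / moment y 0 (kap \<alpha>)" if "\<alpha> > 1" for \<alpha>
    unfolding A_fun_def tilted[OF that less_imp_le[OF y]] using m0[OF kap(1)[OF that]] m0[OF em.c_S]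
    by (simp add: exp_diff c_def)
  have delta: "y * delta_star N \<alpha> y = y + em.D (kap \<alpha>)" if "\<alpha> > 1" for \<alpha>
  proof -
    have F: "em.F (kap \<alpha>) > 0" and M: "moment y 0 (kap \<alpha>) > 0" using em.F_pos kap m0 that by auto
    have K: "moment y 1 (kap \<alpha>) = (\<alpha> - 1) * y * moment y 0 (kap \<alpha>)"
      using kap(3)[OF that] M by (simp add: em.mean_def field_simps)
    show ?thesis unfolding delta_star_def A[OF that] em.D_def K using F M y_pos
      by (simp add: em.F_def divide_simps) (simp add: algebra_simps)
  qed
  have eta: "?X (y * delta_star N \<alpha> y) = em.eta (kap \<alpha>)" if "\<alpha> > 1" for \<alpha>
    by (simp add: delta[OF that] em.eta_def)
  have dge: "m \<le> y * delta_star N \<alpha> y" if "\<alpha> > 1" for \<alpha>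
    using em.D_pos[OF kap(1,2)[OF that]] y by (simp add: delta[OF that])
  have B: "B_hat N \<alpha> y = moment y 0 (em.eta (kap \<alpha>)) * exp (- ((em.eta (kap \<alpha>) - kap \<alpha>) * em.D (kap \<alpha>))) / moment y 0 (kap \<alpha>)"
    if "\<alpha> > 1" for \<alpha>
    unfolding B_hat_def tilted[OF that dge[OF that]] eta[OF that]
    using m0[OF kap(1)[OF that]] m0[OF em.eta_S[OF kap(1,2)[OF that]]]
    by (simp add: exp_diff exp_add exp_minus delta[OF that] field_simps)
  \<comment> \<open>\<open>1 - A - B^\<close> and \<open>em.P\<close> differ by a positive factor, so \<open>gap\<close> controls both signs.\<close>
  have P: "1 - A_fun N \<alpha> y - B_hat N \<alpha> y = em.P (kap \<alpha>) * exp (kap \<alpha> * em.D (kap \<alpha>)) / moment y 0 (kap \<alpha>)"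
    if "\<alpha> > 1" for \<alpha>
  proof -
    have e: "exp (- ((em.eta (kap \<alpha>) - kap \<alpha>) * em.D (kap \<alpha>)))
        = exp (- (em.eta (kap \<alpha>) * em.D (kap \<alpha>))) * exp (kap \<alpha> * em.D (kap \<alpha>))"
      by (simp add: algebra_simps flip: exp_add)
    have e1: "exp (- (kap \<alpha> * em.D (kap \<alpha>))) * exp (kap \<alpha> * em.D (kap \<alpha>)) = 1" by (simp flip: exp_add)
    have "em.P (kap \<alpha>) * exp (kap \<alpha> * em.D (kap \<alpha>))
       = em.F (kap \<alpha>) - moment y 0 (em.eta (kap \<alpha>)) * exp (- ((em.eta (kap \<alpha>) - kap \<alpha>) * em.D (kap \<alpha>)))"
      unfolding em.P_def e by (simp add: left_diff_distrib mult.assoc e1)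
    then show ?thesis unfolding A[OF that] B[OF that] using m0[OF kap(1)[OF that]]
      by (simp add: em.F_def diff_divide_distrib)
  qed
  have L: "L_hat N \<alpha> y = em.P (kap \<alpha>)" if "\<alpha> > 1" for \<alpha>
  proof -
    let ?k = "kap \<alpha>"
    have ay: "m \<le> \<alpha> * y"
    proof -
      have "1 * y \<le> \<alpha> * y" using that y_pos by (intro mult_right_mono) auto
      then show ?thesis using y by simp
    qed
    have kS: "?k \<in> S" using kap that by simp
    have "rate N (\<alpha> * y) = ?k * (\<alpha> * y) - ln (mgf N ?k)"
      unfolding kap_def using rate_critical[OF dual_S[OF ay] crit[OF ay]] .
    also have "ln (mgf N ?k) = ?k * y + ln (moment y 0 ?k)"
      using m0[OF kS] by (simp add: mgf_moment[OF kS, of y] ln_mult)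
    finally have "- rate N (\<alpha> * y) - ?k * y * (delta_star N \<alpha> y - \<alpha>)
        = ln (moment y 0 ?k) + ?k * y - ?k * (y * delta_star N \<alpha> y)"
      by (simp add: algebra_simps)
    also have "\<dots> = ln (moment y 0 ?k) - ?k * em.D ?k" unfolding delta[OF that] by (simp add: algebra_simps)
    finally have ex: "exp (- rate N (\<alpha> * y) - ?k * y * (delta_star N \<alpha> y - \<alpha>)) = moment y 0 ?k * exp (- (?k * em.D ?k))"
      using m0[OF kS] by (simp add: exp_diff exp_minus divide_inverse)
    have "L_hat N \<alpha> y = (1 - A_fun N \<alpha> y - B_hat N \<alpha> y) * exp (- rate N (\<alpha> * y) - ?k * y * (delta_star N \<alpha> y - \<alpha>))"
      unfolding L_hat_def L_fun_def kap_def A_fun_def B_hat_def by (simp add: mult.commute)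
    then show ?thesis unfolding P[OF that] ex using m0[OF kS] by (simp add: exp_minus)
  qed
  have sgn_AB: "A_fun N \<alpha> y + B_hat N \<alpha> y < 1 \<longleftrightarrow> em.gap (kap \<alpha>) < 0"
    "A_fun N \<alpha> y + B_hat N \<alpha> y = 1 \<longleftrightarrow> em.gap (kap \<alpha>) = 0" if "\<alpha> > 1" for \<alpha>
  proof -
    have "sgn (1 - A_fun N \<alpha> y - B_hat N \<alpha> y) = - sgn (em.gap (kap \<alpha>))"
      unfolding P[OF that] using em.sgn_P[OF kap(1,2)[OF that]] m0[OF kap(1)[OF that]]
      by (simp add: sgn_mult sgn_divide)
    then show "A_fun N \<alpha> y + B_hat N \<alpha> y < 1 \<longleftrightarrow> em.gap (kap \<alpha>) < 0"
      "A_fun N \<alpha> y + B_hat N \<alpha> y = 1 \<longleftrightarrow> em.gap (kap \<alpha>) = 0"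
      by (auto simp: sgn_if split: if_splits)
  qed
  have kap_check: "al em.kap_check > 1" "kap (al em.kap_check) = em.kap_check" using al_gt kap_al em.kap_check by auto
  have kap_hat: "al em.kap_hat > 1" "kap (al em.kap_hat) = em.kap_hat" using al_gt kap_al em.kap_hat by auto
  have check: "alpha_check N y = al em.kap_check"
    unfolding alpha_check_def
  proof (rule the_equality)
    have less: "delta_star N (al em.kap_check) y < delta_star N \<alpha> y" if "\<alpha> > 1" "\<alpha> \<noteq> al em.kap_check" for \<alpha>
    proof -
      have "kap \<alpha> \<noteq> em.kap_check" using that al_kap by metis
      then have "y * delta_star N (al em.kap_check) y < y * delta_star N \<alpha> y"
        using em.D_minimum[OF kap(1,2)[OF that(1)]] by (simp add: delta kap_check that)
      then show ?thesis using y_pos by simp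
    qed
    show "is_arg_min (\<lambda>\<alpha>. delta_star N \<alpha> y) (\<lambda>\<alpha>. 1 < \<alpha>) (al em.kap_check)"
      unfolding is_arg_min_def using kap_check less by (metis less_asym less_irrefl)
    show "a = al em.kap_check" if "is_arg_min (\<lambda>\<alpha>. delta_star N \<alpha> y) (\<lambda>\<alpha>. 1 < \<alpha>) a" for a
      using that kap_check less unfolding is_arg_min_def by blast
  qed
  have hat: "alpha_hat N y = al em.kap_hat"
    unfolding alpha_hat_def check
  proof (rule the_equality)
    have "al em.kap_hat < al em.kap_check" using kap_less[of "al em.kap_hat" "al em.kap_check"] kap_check kap_hat em.kap_hat by simp
    moreover have "A_fun N \<alpha> y + B_hat N \<alpha> y < 1" if "1 < \<alpha>" "\<alpha> < al em.kap_hat" for \<alpha>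
      using that sgn_AB(1)[of \<alpha>] em.gap_neg[of "kap \<alpha>"] kap(2)[of \<alpha>] kap_less[of \<alpha> "al em.kap_hat"] kap_hat by simp
    ultimately show "al em.kap_hat \<in> {1<..<al em.kap_check} \<and> A_fun N (al em.kap_hat) y + B_hat N (al em.kap_hat) y = 1 \<and>
      (\<forall>\<alpha>\<in>{1<..<al em.kap_hat}. A_fun N \<alpha> y + B_hat N \<alpha> y < 1)"
      using kap_hat sgn_AB(2)[of "al em.kap_hat"] em.kap_hat by auto
    fix a assume "a \<in> {1<..<al em.kap_check} \<and> A_fun N a y + B_hat N a y = 1 \<and>
      (\<forall>\<alpha>\<in>{1<..<a}. A_fun N \<alpha> y + B_hat N \<alpha> y < 1)"
    then have a: "a > 1" "em.gap (kap a) = 0" using sgn_AB(2)[of a] by auto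
    then have "kap a = em.kap_hat"
      using em.gap_neg[of "kap a"] em.gap_pos[of "kap a"] kap[OF a(1)]
      by (metis less_irrefl linorder_neqE_linordered_idom)
    then show "a = al em.kap_hat" using al_kap a by metis
  qed
  obtain ks where ks: "c < ks" "ks < em.kap_hat" "\<And>\<kappa>. \<kappa> \<in> S \<Longrightarrow> c < \<kappa> \<Longrightarrow> \<kappa> \<noteq> ks \<Longrightarrow> em.P \<kappa> < em.P ks"
    using em.unique_maximum by blast
  have ksS: "ks \<in> S" using em.S_down[OF em.kap_hat(4)] ks by simp
  have al_ks: "al ks > 1" "kap (al ks) = ks" using al_gt kap_al ksS ks by auto
  have "al ks < al em.kap_hat" using kap_less[of "al ks" "al em.kap_hat"] al_ks kap_hat ks by simp
  moreover have "L_hat N \<alpha> y < L_hat N (al ks) y" if "\<alpha> > 1" "\<alpha> \<noteq> al ks" for \<alpha>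
  proof -
    have "kap \<alpha> \<noteq> ks" using al_kap[OF that(1)] that(2) by metis
    then show ?thesis
      using L[OF that(1)] L[OF al_ks(1)] ks(3)[OF kap(1,2)[OF that(1)]] al_ks(2) by simp
  qed
  ultimately show ?thesis unfolding hat using al_ks(1) by (intro bexI[of _ "al ks"]) auto
qed

end

theorem theorem4p4:
  fixes M :: "'a measure" and X :: "'a \<Rightarrow> real" and \<xi>s :: ereal
    and N :: "real measure" and m :: real
  defines "N \<equiv> distr M borel X"
    and "m \<equiv> (\<integral>\<omega>. X \<omega> \<partial>M)"
  assumes "prob_space M"
    and "X \<in> borel_measurable M"
    and "AE \<omega> in M. 0 < X \<omega>"
    and "0 < \<xi>s"
    and "\<And>\<xi>. ereal \<xi> < \<xi>s \<Longrightarrow> integrable M (\<lambda>\<omega>. exp (\<xi> * X \<omega>))"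
    and "\<And>t. t \<ge> m \<Longrightarrow>
          is_arg_max (\<lambda>\<xi>. \<xi> * t - ln (mgf N \<xi>)) (\<lambda>\<xi>. \<xi> \<in> mgf_dom N \<and> \<xi> \<ge> 0) (legendre_dual N t)
          \<and> ereal (legendre_dual N t) < \<xi>s"
    and "mono_on {m..} (legendre_dual N)"
    and "concave_on {m..} (legendre_dual N)"
    and "legendre_dual N m = 0"
  shows "\<forall>y>m. \<exists>a\<in>{1<..<alpha_hat N y}.
           is_arg_max (\<lambda>\<alpha>. L_hat N \<alpha> y) (\<lambda>\<alpha>. 1 < \<alpha>) a \<and>
           (\<forall>b. is_arg_max (\<lambda>\<alpha>. L_hat N \<alpha> y) (\<lambda>\<alpha>. 1 < \<alpha>) b \<longrightarrow> b = a)"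
proof (intro allI impI)
  fix y assume y: "m < y"
  interpret M: prob_space M by fact
  interpret N: prob_space N unfolding N_def using assms(4) by (rule M.prob_space_distr)
  interpret exponential_tail_law N "{\<kappa>. ereal \<kappa> < \<xi>s}"
  proof
    show "sets N = sets borel" by (simp add: N_def)
    fix \<kappa> assume \<kappa>: "\<kappa> \<in> {\<kappa>. ereal \<kappa> < \<xi>s}"
    show "\<kappa>' \<in> {\<kappa>. ereal \<kappa> < \<xi>s}" if "\<kappa>' \<le> \<kappa>" for \<kappa>'
      using \<kappa> that by (auto intro: le_less_trans[of "ereal \<kappa>'" "ereal \<kappa>"])
    show "\<exists>\<kappa>'>\<kappa>. \<kappa>' \<in> {\<kappa>. ereal \<kappa> < \<xi>s}"
      using \<kappa> ereal_dense2[of "ereal \<kappa>" \<xi>s] by auto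
    show "integrable N (\<lambda>t. exp (\<kappa> * t))"
      unfolding N_def using assms(4,7) \<kappa> by (subst integrable_distr_eq) auto
  qed
  have m_int: "m = (\<integral>x. x \<partial>N)" unfolding m_def N_def using assms(4) by (subst integral_distr) auto
  have "m \<ge> 0" unfolding m_def using assms(5) by (intro integral_nonneg_AE) auto
  then obtain a where a: "a \<in> {1<..<alpha_hat N y}"
      "\<And>\<alpha>. \<alpha> > 1 \<Longrightarrow> \<alpha> \<noteq> a \<Longrightarrow> L_hat N \<alpha> y < L_hat N a y"
    using L_hat_unique_maximum[OF _ m_int _ _ _ assms(9,10) y] assms(6,8) by (auto simp: zero_ereal_def)
  have "is_arg_max (\<lambda>\<alpha>. L_hat N \<alpha> y) (\<lambda>\<alpha>. 1 < \<alpha>) a"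
    unfolding is_arg_max_def using a by (metis greaterThanLessThan_iff less_asym less_irrefl)
  moreover have "b = a" if "is_arg_max (\<lambda>\<alpha>. L_hat N \<alpha> y) (\<lambda>\<alpha>. 1 < \<alpha>) b" for b
    using that a unfolding is_arg_max_def by (metis greaterThanLessThan_iff)
  ultimately show "\<exists>a\<in>{1<..<alpha_hat N y}. is_arg_max (\<lambda>\<alpha>. L_hat N \<alpha> y) (\<lambda>\<alpha>. 1 < \<alpha>) a \<and>
           (\<forall>b. is_arg_max (\<lambda>\<alpha>. L_hat N \<alpha> y) (\<lambda>\<alpha>. 1 < \<alpha>) b \<longrightarrow> b = a)"
    using a(1) by blast
qed

end
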